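(* Let $n$ be a positive integer, $m$ an integer with $0 \le m \le n$, $\tau > 0$, $a_0, \dotsc, a_{n-1}, \alpha_0, \dotsc, \alpha_m \in \mathbb R$, and let $\Delta: \mathbb C \to \mathbb C$ be the quasipolynomial \[ \Delta(s) = s^n + \sum_{k=0}^{n-1} a_k s^k + e^{-s\tau} \sum_{k=0}^{m} \alpha_k s^k . \] Let $s_0 \in \mathbb R$ and assume that \[ a_k = \binom{n}{k} (-s_0)^{n-k} + (-1)^{n-k}\, n! \sum_{j=k}^{n-1} \frac{\binom{j}{k}\binom{m+n-j}{m} s_0^{j-k}}{j!\,\tau^{n-j}} \quad \text{for every integer } k \text{ with } 0 \le k \le n-1, \] and \[ \alpha_k = (-1)^{n-1} e^{s_0 \tau} \sum_{j=k}^{m} \frac{(-1)^{j-k} (m+n-j)!\, s_0^{j-k}}{k!\,(j-k)!\,(m-j)!\,\tau^{n-j}} \quad \text{for every integer } k \text{ with } 0 \le k \le m . \] Then the following hold. (a) (Retarded) If $m < n$, then $s_0$ is a strictly dominant root of $\Delta$. (b) (Neutral) If $m = n$, then $s_0$ is a dominant root of $\Delta$ and, for every other complex root $s$ of $\Delta$, one has $\Re(s) = s_0$. More precisely, the set of roots of $\Delta$ is $\left\{ s_0 + i \frac{\zeta}{\tau} : \zeta \in \Xi_n \right\}$, where \[ \Xi_n = \left\{ \zeta \in \mathbb R : \tan\left(\frac{\zeta}{2}\right) = \frac{\displaystyle \zeta \sum_{\ell=0}^{\lfloor \frac{n-1}{2} \rfloor} (-1)^\ell \frac{(2n-2\ell-1)!}{(2\ell+1)!\,(n-2\ell-1)!}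 \zeta^{2\ell}}{\displaystyle \sum_{\ell=0}^{\lfloor \frac{n}{2} \rfloor} (-1)^\ell \frac{(2n-2\ell)!}{(2\ell)!\,(n-2\ell)!} \zeta^{2\ell}} \right\} . \]
   Context: A root $s_0$ of a function $Q: \mathbb C \to \mathbb C$ is called dominant (respectively, strictly dominant) if, for every $s \in \mathbb C \setminus \{s_0\}$ such that $Q(s) = 0$, one has $\Re(s) \le \Re(s_0)$ (respectively, $\Re(s) < \Re(s_0)$). The convention $x^0 = 1$ is used, including when $x = 0$. Membership in $\Xi_n$ requires both sides of the defining equation to be well defined. *)

theory Defs
  imports Complex_Main
begin

definition dominant_root :: "(complex \<Rightarrow> complex) \<Rightarrow> complex \<Rightarrow> bool" where
  "dominant_root Q s0 \<longleftrightarrow>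
     Q s0 = 0 \<and> (\<forall>s. s \<noteq> s0 \<longrightarrow> Q s = 0 \<longrightarrow> Re s \<le> Re s0)"

definition strictly_dominant_root :: "(complex \<Rightarrow> complex) \<Rightarrow> complex \<Rightarrow> bool" where
  "strictly_dominant_root Q s0 \<longleftrightarrow>
     Q s0 = 0 \<and> (\<forall>s. s \<noteq> s0 \<longrightarrow> Q s = 0 \<longrightarrow> Re s < Re s0)"

text \<open>Only the values of \<open>a\<close> below \<open>n\<close> and those of \<open>\<alpha>\<close> up to \<open>m\<close> matter.\<close>

definition quasipolynomial ::
  "nat \<Rightarrow> nat \<Rightarrow> real \<Rightarrow> (nat \<Rightarrow> real) \<Rightarrow> (nat \<Rightarrow> real) \<Rightarrow> complex \<Rightarrow> complex" where
  "quasipolynomial n m \<tau> a \<alpha> s =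
     s ^ n + (\<Sum>k<n. complex_of_real (a k) * s ^ k)
       + exp (- s * complex_of_real \<tau>) * (\<Sum>k\<le>m. complex_of_real (\<alpha> k) * s ^ k)"

definition Xi_num :: "nat \<Rightarrow> real \<Rightarrow> real" where
  "Xi_num n \<zeta> = \<zeta> * (\<Sum>l\<le>(n - 1) div 2.
     (-1) ^ l * (fact (2 * n - 2 * l - 1) / (fact (2 * l + 1) * fact (n - 2 * l - 1)))
       * \<zeta> ^ (2 * l))"

definition Xi_den :: "nat \<Rightarrow> real \<Rightarrow> real" where
  "Xi_den n \<zeta> = (\<Sum>l\<le>n div 2.
     (-1) ^ l * (fact (2 * n - 2 * l) / (fact (2 * l) * fact (n - 2 * l)))
       * \<zeta> ^ (2 * l))"

text \<open>Since \<open>tan\<close> and division are total in HOL, with value \<open>0\<close> at the poles of \<open>tan\<close> and for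
  a zero denominator, the two disequalities are needed to say that both sides of the equation
  are well defined.\<close>

definition Xi :: "nat \<Rightarrow> real set" where
  "Xi n = {\<zeta>. cos (\<zeta> / 2) \<noteq> 0 \<and> Xi_den n \<zeta> \<noteq> 0 \<and>
               tan (\<zeta> / 2) = Xi_num n \<zeta> / Xi_den n \<zeta>}"

end

theory Submission
  imports Defs "HOL-Analysis.Analysis" "HOL-Computational_Algebra.Fundamental_Theorem_Algebra"
begin

text \<open>
  Put \<open>z = \<tau> (s - s0)\<close>. The prescribed coefficients are exactly those for which
  \<open>\<tau> ^ n * \<Delta>(s) = P z + exp (- z) * Q z\<close>, where \<open>- Q / P\<close> is the Pade approximant of \<open>exp\<close> with
  numerator degree \<open>m\<close> and denominator degree \<open>n\<close> (\<open>quasipolynomial_undelayed_part\<close>,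
  \<open>quasipolynomial_delayed_part\<close>). Hence the right-hand side vanishes at \<open>0\<close> to order
  \<open>m + n + 1\<close>, the largest possible, and the question is where its other zeros lie.

  Both \<open>exp (z / 2) * P z\<close> and \<open>exp (- z / 2) * Q z\<close> solve the Bessel-type equation
  \<open>z V'' - (m + n) V' = (z / 4 + \<kappa>) V\<close> with \<open>\<kappa> = (n - m) / 2\<close>. So does their sum \<open>V\<close>, and dividing
  by \<open>z ^ (m + n + 1)\<close> leaves an entire \<open>G\<close> with \<open>G 0 \<noteq> 0\<close> and
  \<open>z G'' + b G' = (z / 4 + \<kappa>) G\<close>, \<open>b = m + n + 2\<close>. If \<open>G z = 0\<close>, consider
  \<open>h t = t ^ b * Re (G' (t z) * cnj (G (t z)))\<close> on \<open>[0, 1]\<close>: it vanishes at both ends, and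
  \<open>h' t = t ^ (b - 1) (t Re z / 4 + \<kappa>) \<bar>G\<bar>\<^sup>2 + t ^ b Re z \<bar>G'\<bar>\<^sup>2\<close>. This is Hille's energy argument. It
  excludes \<open>Re z > 0\<close> always and \<open>Re z = 0\<close> when \<open>\<kappa> > 0\<close> (\<open>zeros_of_radial_ode\<close>); when \<open>\<kappa> = 0\<close> the
  equation is invariant under \<open>z \<mapsto> - z\<close>, which excludes \<open>Re z < 0\<close> as well. The outcome is
  \<open>pade_root_location\<close>, from which the retarded case and the vertical line in the neutral case follow.

  For \<open>m = n\<close> and \<open>z = \<i> \<zeta>\<close> the values \<open>P z\<close> and \<open>- Q z\<close> are complex conjugates of each other, and
  the equation becomes the real one \<open>sin (\<zeta> / 2) * Xi_den n \<zeta> = cos (\<zeta> / 2) * Xi_num n \<zeta>\<close>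
  (\<open>diagonal_root_iff\<close>). To divide by the cosine and by \<open>Xi_den\<close> it must be shown that neither vanishes
  at a solution. If \<open>Xi_den n \<zeta>\<close> vanished but the cosine did not, then \<open>Xi_num n \<zeta> = 0\<close>, making \<open>\<i> \<zeta>\<close>
  a common zero of \<open>P\<close> and \<open>Q\<close>; their Wronskian, a nonzero multiple of \<open>z ^ (m + n)\<close>, forbids this.
  If the cosine vanished, then \<open>Xi_den n \<zeta> = 0\<close> too, so \<open>\<i> \<zeta>\<close> would be an algebraic number
  with \<open>exp (\<i> \<zeta>) = -1\<close>. This is an arithmetic obstruction, not an analytic one: it amounts to
  the transcendence of \<open>\<pi>\<close>, which is proved here by Hermite's method
  (\<open>algebraic_imp_exp_neq_minus_one\<close>).

  The symmetric function theorem needed there is replaced by logarithmic derivatives of power series.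
  If a list of numbers has rational power sums, then \<open>Y = \<Prod> (1 + exp (x t))\<close> over the list satisfies
  \<open>Y' = Y R\<close>, where \<open>R\<close> has rational coefficients; hence so has \<open>Y\<close>. But \<open>Y\<close> is also the exponential
  generating function of the power sums of all subset sums of the list, so these are rational.
\<close>

section \<open>Zeros of a radial second-order equation\<close>

text \<open>
  In self-adjoint form the equation along the ray \<open>t z\<close> reads
  \<open>(t ^ b g')' = t ^ (b - 1) (t z / 4 + \<kappa>) g\<close>. Multiplying by the conjugate of \<open>g\<close> and taking real
  parts makes the flux \<open>h\<close> monotone; since it vanishes at both ends of \<open>[0, 1]\<close>, it is constant, which
  forces \<open>g = 0\<close> on the ray and so \<open>g 0 = 0\<close>.
\<close>

lemma zeros_of_radial_ode:
  fixes g g' g'' :: "complex \<Rightarrow> complex" and \<kappa> :: real and b :: nat and z :: complex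
  assumes g: "\<And>w. (g has_field_derivative g' w) (at w)"
    and g': "\<And>w. (g' has_field_derivative g'' w) (at w)"
    and ode: "\<And>w. w * g'' w + of_nat b * g' w = (w / 4 + of_real \<kappa>) * g w"
    and b: "b > 0" and g0: "g 0 \<noteq> 0"
    and zero: "g z = 0" and \<kappa>: "\<kappa> \<ge> 0" and pos: "Re z > 0 \<or> Re z = 0 \<and> \<kappa> > 0"
  shows False
proof -
  define h where "h t = t ^ b * Re (g' (of_real t * z) * cnj (g (of_real t * z)))" for t :: real
  define h' where "h' t = t ^ (b - 1) * (t * Re z / 4 + \<kappa>) * (norm (g (of_real t * z)))\<^sup>2 +
      t ^ b * Re z * (norm (g' (of_real t * z)))\<^sup>2" for t :: real
  have deriv: "(h has_real_derivative h' t) (at t)" for t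
  proof -
    have lin: "((\<lambda>t. of_real t * z) has_vector_derivative z) (at t)"
      by (auto simp: has_vector_derivative_def scaleR_conv_of_real intro!: derivative_eq_intros)
    have 1: "((\<lambda>t. g (of_real t * z)) has_vector_derivative (z * g' (of_real t * z))) (at t)"
      using field_vector_diff_chain_at[of "\<lambda>t. of_real t * z" z t g "g' (of_real t * z)", OF lin g]
      by (simp only: o_def)
    have 2: "((\<lambda>t. g' (of_real t * z)) has_vector_derivative (z * g'' (of_real t * z))) (at t)"
      using field_vector_diff_chain_at[of "\<lambda>t. of_real t * z" z t g' "g'' (of_real t * z)", OF lin g']
      by (simp only: o_def)
    have 3: "((\<lambda>t. complex_of_real (t ^ b)) has_vector_derivative of_real (of_nat b * t ^ (b - 1))) (at t)"
      by (rule has_vector_derivative_of_real)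
         (auto intro!: derivative_eq_intros simp: has_real_derivative_iff_has_vector_derivative[symmetric])
    let ?g = "g (of_real t * z)" and ?g' = "g' (of_real t * z)" and ?g'' = "g'' (of_real t * z)"
    have "((\<lambda>t. complex_of_real (t ^ b) * (g' (of_real t * z) * cnj (g (of_real t * z))))
        has_vector_derivative
          of_real (t ^ b) * (?g' * cnj (z * ?g') + z * ?g'' * cnj ?g) +
          of_real (of_nat b * t ^ (b - 1)) * (?g' * cnj ?g)) (at t)"
      by (intro has_vector_derivative_mult 1 2 3 has_vector_derivative_cnj)
    then have "((\<lambda>t. Re (complex_of_real (t ^ b) * (g' (of_real t * z) * cnj (g (of_real t * z)))))
        has_vector_derivative
          Re (of_real (t ^ b) * (?g' * cnj (z * ?g') + z * ?g'' * cnj ?g) +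
          of_real (of_nat b * t ^ (b - 1)) * (?g' * cnj ?g))) (at t)"
      by (rule bounded_linear.has_vector_derivative[OF bounded_linear_Re])
    moreover have "of_real (t ^ b) * (?g' * cnj (z * ?g') + z * ?g'' * cnj ?g) +
          of_real (of_nat b * t ^ (b - 1)) * (?g' * cnj ?g) =
        of_real (t ^ (b - 1)) * ((of_real t * z * ?g'' + of_nat b * ?g') * cnj ?g) +
        of_real (t ^ b) * (cnj z * (?g' * cnj ?g'))"
      using b by (cases b) (simp_all add: algebra_simps)
    also have "\<dots> = of_real (t ^ (b - 1)) * ((of_real t * z / 4 + of_real \<kappa>) * (?g * cnj ?g)) +
        of_real (t ^ b) * (cnj z * (?g' * cnj ?g'))"
      unfolding ode by (simp only: mult.assoc)
    also have "\<dots> = of_real (t ^ (b - 1)) * ((of_real t * z / 4 + of_real \<kappa>) * of_real ((norm ?g)\<^sup>2)) +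
        of_real (t ^ b) * (cnj z * of_real ((norm ?g')\<^sup>2))"
      unfolding complex_norm_square by (rule refl)
    also have "Re \<dots> = h' t"
      by (simp add: h'_def mult.assoc)
    ultimately show ?thesis
      unfolding h_def has_real_derivative_iff_has_vector_derivative by (simp add: mult.assoc)
  qed
  have h'_nonneg: "h' t \<ge> 0" if "t \<ge> 0" for t
    unfolding h'_def using that pos \<kappa>
    by (intro add_nonneg_nonneg mult_nonneg_nonneg) auto
  have mono: "h s \<le> h t" if "0 \<le> s" "s \<le> t" for s t
    by (rule DERIV_nonneg_imp_nondecreasing[OF that(2)]) (use that deriv h'_nonneg in fastforce)
  have "h 0 = 0" "h 1 = 0" using b zero by (simp_all add: h_def)
  then have h0: "h t = 0" if "0 \<le> t" "t \<le> 1" for t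
    using mono[of 0 t] mono[of t 1] that by simp
  have "g (of_real t * z) = 0" if t: "0 < t" "t < 1" for t
  proof -
    have "(h has_real_derivative 0) (at t)"
    proof (rule has_field_derivative_transform_within_open[of "\<lambda>_. 0" _ _ "{0<..<1}"])
      show "((\<lambda>_. 0) has_real_derivative 0) (at t)" by simp
    qed (use t h0 in auto)
    then have "h' t = 0" using deriv[of t] by (rule DERIV_unique[symmetric])
    moreover have "t ^ b * Re z * (norm (g' (of_real t * z)))\<^sup>2 \<ge> 0"
      using t pos by (intro mult_nonneg_nonneg) auto
    moreover have "t * Re z / 4 + \<kappa> > 0"
      using t pos \<kappa> by (auto intro: add_pos_nonneg)
    ultimately have "t ^ (b - 1) * (t * Re z / 4 + \<kappa>) * (norm (g (of_real t * z)))\<^sup>2 \<le> 0"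
      unfolding h'_def by linarith
    moreover have "t ^ (b - 1) * (t * Re z / 4 + \<kappa>) > 0"
      using t \<open>t * Re z / 4 + \<kappa> > 0\<close> by simp
    ultimately have "(norm (g (of_real t * z)))\<^sup>2 \<le> 0"
      by (meson mult_pos_pos not_le)
    then show ?thesis by simp
  qed
  then have "\<forall>\<^sub>F t in at_right 0. g (of_real t * z) = 0"
    by (auto simp: eventually_at_right_field intro!: exI[of _ "1::real"])
  then have "((\<lambda>t. g (of_real t * z)) \<longlongrightarrow> 0) (at_right 0)"
    by (rule tendsto_eventually)
  moreover have "((\<lambda>t. g (of_real t * z)) \<longlongrightarrow> g (of_real 0 * z)) (at_right 0)"
  proof (rule isCont_tendsto_compose[of "of_real 0 * z" g])
    show "isCont g (of_real 0 * z)" using g by (rule DERIV_isCont)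
  qed (intro tendsto_intros)
  ultimately have "g (of_real 0 * z) = 0"
    using tendsto_unique trivial_limit_at_right_real by blast
  then show False using g0 by simp
qed

section \<open>The Pade pair of the exponential and its Wronskian\<close>

text \<open>
  Up to a common constant factor and signs, \<open>pade_P\<close> is the denominator and \<open>pade_Q\<close> the numerator of the
  Pade approximant of \<open>exp\<close> of type \<open>(m, n)\<close>, normalised so that \<open>pade_P\<close> is monic.
\<close>

definition pade_P :: "nat \<Rightarrow> nat \<Rightarrow> complex poly" where
  "pade_P n m = (\<Sum>j\<le>n. monom ((-1) ^ (n - j) * (fact n * fact (m + n - j)) / (fact m * (fact j * fact (n - j)))) j)"

definition pade_Q :: "nat \<Rightarrow> nat \<Rightarrow> complex poly" where
  "pade_Q n m = (\<Sum>j\<le>m. monom ((-1) ^ (n - 1) * fact (m + n - j) / (fact j * fact (m - j))) j)"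

lemma coeff_pade_P: "coeff (pade_P n m) j = (if j \<le> n then
    (-1) ^ (n - j) * (fact n * fact (m + n - j)) / (fact m * (fact j * fact (n - j))) else 0)"
  by (simp add: pade_P_def coeff_sum)

lemma coeff_pade_Q: "coeff (pade_Q n m) j = (if j \<le> m then
    (-1) ^ (n - 1) * fact (m + n - j) / (fact j * fact (m - j)) else 0)"
  by (simp add: pade_Q_def coeff_sum)

lemma poly_pade_P: "poly (pade_P n m) z = (\<Sum>j\<le>n. coeff (pade_P n m) j * z ^ j)"
  unfolding pade_P_def by (simp add: poly_sum poly_monom coeff_sum)

lemma poly_pade_Q: "poly (pade_Q n m) z = (\<Sum>j\<le>m. coeff (pade_Q n m) j * z ^ j)"
  unfolding pade_Q_def by (simp add: poly_sum poly_monom coeff_sum)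

lemma pade_P_recurrence:
  "of_nat (Suc k) * (of_nat k - of_nat (m + n)) * coeff (pade_P n m) (Suc k) =
     (of_nat n - of_nat k) * coeff (pade_P n m) k"
proof (cases "k < n")
  case True
  then obtain d where d: "n = Suc (k + d)" by (auto simp: less_iff_Suc_add)
  have [simp]: "Suc (m + (k + d)) - k = Suc (m + d)" by simp
  have "(of_nat d + 1 :: complex) \<noteq> 0" "(of_nat k + 1 :: complex) \<noteq> 0" 
    by (metis of_nat_Suc of_nat_neq_0 add.commute)+
  then show ?thesis
    by (simp add: coeff_pade_P d divide_simps) (simp add: algebra_simps)
next
  case False
  then show ?thesis by (auto simp: coeff_pade_P)
qed

lemma pade_Q_recurrence:
  "of_nat (Suc k) * (of_nat (m + n) - of_nat k) * coeff (pade_Q n m) (Suc k) =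
     (of_nat m - of_nat k) * coeff (pade_Q n m) k"
proof (cases "k < m")
  case True
  then obtain d where d: "m = Suc (k + d)" by (auto simp: less_iff_Suc_add)
  have [simp]: "Suc (k + d + n) - k = Suc (n + d)" "k + d + n - k = n + d" by simp_all
  have "(of_nat d + 1 :: complex) \<noteq> 0" "(of_nat k + 1 :: complex) \<noteq> 0" 
    by (metis of_nat_Suc of_nat_neq_0 add.commute)+
  then show ?thesis
    by (simp add: coeff_pade_Q d divide_simps) (simp add: algebra_simps)
next
  case False
  then show ?thesis by (auto simp: coeff_pade_Q)
qed

text \<open>
  The ratio of consecutive coefficients is hypergeometric, so each of the two polynomials satisfies a
  confluent hypergeometric equation. Everything needed about \<open>pade_P\<close> and \<open>pade_Q\<close> is
  deduced from these two equations and from the coefficients of lowest and highest degree, with no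
  summation of binomial coefficients.
\<close>

lemma pade_P_ode:
  fixes n m
  defines "P \<equiv> pade_P n m"
  shows "[:0, 1:] * pderiv (pderiv P) = of_nat n * P - ([:0, 1:] - of_nat (m + n)) * pderiv P"
proof (rule poly_eqI)
  fix k
  have *: "of_nat j * p = smult (of_nat j) p" for j and p :: "complex poly"
    by (simp add: of_nat_poly)
  show "coeff ([:0, 1:] * pderiv (pderiv P)) k =
      coeff (of_nat n * P - ([:0, 1:] - of_nat (m + n)) * pderiv P) k"
  proof (cases k)
    case 0
    have "of_nat n * coeff P 0 = - (of_nat (m + n) * coeff P (Suc 0))"
      using pade_P_recurrence[of 0 m n] by (simp add: P_def del: of_nat_add)
    then show ?thesis
      unfolding left_diff_distrib * 0
      by (simp add: coeff_pderiv del: of_nat_add)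
  next
    case (Suc i)
    then show ?thesis using pade_P_recurrence[of k m n]
      unfolding left_diff_distrib * P_def
      by (simp add: coeff_pderiv algebra_simps)
  qed
qed

lemma pade_Q_ode:
  fixes n m
  defines "Q \<equiv> pade_Q n m"
  shows "[:0, 1:] * pderiv (pderiv Q) = ([:0, 1:] + of_nat (m + n)) * pderiv Q - of_nat m * Q"
proof (rule poly_eqI)
  fix k
  have *: "of_nat j * p = smult (of_nat j) p" for j and p :: "complex poly"
    by (simp add: of_nat_poly)
  show "coeff ([:0, 1:] * pderiv (pderiv Q)) k =
      coeff (([:0, 1:] + of_nat (m + n)) * pderiv Q - of_nat m * Q) k"
    using pade_Q_recurrence[of k m n]
    unfolding distrib_right * Q_def
    by (cases k) (simp_all add: coeff_pderiv algebra_simps)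
qed

text \<open>
  The left-hand side \<open>w\<close> is \<open>exp z\<close> times the Wronskian of \<open>P\<close> and \<open>exp (- z) * Q\<close>. The two equations turn
  into Euler's equation \<open>z w' = (m + n) w\<close>, whose polynomial solutions are monomials; the
  coefficient is the product of the leading coefficients of \<open>- P\<close> and \<open>Q\<close>.
\<close>

lemma pade_wronskian:
  fixes n m
  assumes n: "n > 0"
  defines "P \<equiv> pade_P n m" and "Q \<equiv> pade_Q n m"
  obtains c where "c \<noteq> 0" "P * (pderiv Q - Q) - pderiv P * Q = monom c (m + n)"
proof -
  define w where "w = P * (pderiv Q - Q) - pderiv P * Q"
  define X :: "complex poly" where "X = [:0, 1:]"
  have "X * pderiv w = P * (X * pderiv (pderiv Q)) - X * P * pderiv Q
      - X * pderiv P * Q - (X * pderiv (pderiv P)) * Q"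
    by (simp add: w_def pderiv_add pderiv_diff pderiv_mult algebra_simps)
  also have "\<dots> = of_nat (m + n) * w"
    unfolding X_def P_def Q_def pade_P_ode pade_Q_ode
    unfolding X_def[symmetric] P_def[symmetric] Q_def[symmetric] w_def
    by (simp add: algebra_simps)
  finally have ode: "X * pderiv w = of_nat (m + n) * w" .
  have "coeff w k = 0" if "k \<noteq> m + n" for k
  proof -
    have "of_nat k * coeff w k = of_nat (m + n) * coeff w k"
      using arg_cong[OF ode, of "\<lambda>p. coeff p k"]
      by (cases k) (simp_all add: X_def of_nat_poly coeff_pderiv)
    then show ?thesis using that by (metis mult_cancel_right of_nat_eq_iff)
  qed
  then have w: "w = monom (coeff w (m + n)) (m + n)"
    by (intro poly_eqI) auto
  have dP: "degree P = n" and dQ: "degree Q = m"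
    by (intro antisym degree_le le_degree; simp add: P_def Q_def coeff_pade_P coeff_pade_Q)+
  have "coeff w (m + n) = - (lead_coeff P * lead_coeff Q)"
  proof -
    have "coeff (P * Q) (m + n) = lead_coeff P * lead_coeff Q"
      using coeff_mult_degree_sum[of P Q] by (simp add: dP dQ add.commute)
    moreover have "coeff (pderiv P * Q) (m + n) = 0"
      using degree_mult_le[of "pderiv P" Q] n
      by (intro coeff_eq_0) (simp add: degree_pderiv dP dQ)
    moreover have "coeff (P * pderiv Q) (m + n) = 0"
    proof (cases "m = 0")
      case True
      then have "pderiv Q = 0" using dQ by (simp add: pderiv_eq_0_iff)
      then show ?thesis by simp
    next
      case False
      then show ?thesis using degree_mult_le[of P "pderiv Q"]
        by (intro coeff_eq_0) (simp add: degree_pderiv dP dQ)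
    qed
    ultimately show ?thesis by (simp add: w_def ring_distribs)
  qed
  moreover have "P \<noteq> 0" "Q \<noteq> 0"
    using coeff_pade_P[of n m 0] coeff_pade_Q[of n m 0] by (auto simp: P_def Q_def)
  ultimately have "coeff w (m + n) \<noteq> 0" by simp
  then show ?thesis using that w unfolding w_def by blast
qed

text \<open>
  The indices of the equation at \<open>0\<close> are \<open>0\<close> and \<open>N + 1\<close>: looking at the lowest nonzero coefficient, one
  sees that a nonzero solution with \<open>V(0) = 0\<close> starts exactly with the power \<open>N + 1\<close>. This gives the high
  order of contact of the Pade approximant at once.
\<close>

lemma subdegree_of_bessel_ode:
  fixes V :: "complex fps" and \<kappa> :: complex
  assumes ode: "fps_X * fps_deriv (fps_deriv V) - of_nat N * fps_deriv V =
      (fps_const (1 / 4) * fps_X + fps_const \<kappa>) * V"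
    and V: "V \<noteq> 0" "fps_nth V 0 = 0"
  defines "G \<equiv> fps_shift (Suc N) V"
  shows "V = fps_X ^ Suc N * G" "fps_nth G 0 \<noteq> 0"
    "fps_X * fps_deriv (fps_deriv G) + of_nat (N + 2) * fps_deriv G =
      (fps_const (1 / 4) * fps_X + fps_const \<kappa>) * G"
proof -
  have rec: "of_nat (Suc k) * (of_nat k - of_nat N) * fps_nth V (Suc k) =
      (if k = 0 then 0 else fps_nth V (k - 1) / 4) + \<kappa> * fps_nth V k" for k
    using arg_cong[OF ode, of "\<lambda>f. fps_nth f k"]
    by (cases k) (simp_all add: algebra_simps fps_of_nat[symmetric])
  have nz: "fps_nth V (subdegree V) \<noteq> 0" using V(1) by simp
  then have "subdegree V \<noteq> 0" using V(2) by (intro notI) simp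
  then obtain k where k: "subdegree V = Suc k" by (cases "subdegree V") auto
  have "fps_nth V k = 0" "fps_nth V (k - 1) = 0"
    using k by (auto intro!: nth_less_subdegree_zero)
  then have "of_nat (Suc k) * (of_nat k - of_nat N) * fps_nth V (Suc k) = 0"
    using rec[of k] by simp
  then have "of_nat k = (of_nat N :: complex)" using nz k by (simp del: of_nat_Suc)
  then have sub: "subdegree V = Suc N" using k by simp
  show G: "V = fps_X ^ Suc N * G"
    using fps_shift_times_fps_X_power[of "Suc N" V] sub
    by (simp add: G_def mult.commute del: power_Suc)
  show "fps_nth G 0 \<noteq> 0" using nz sub by (simp add: G_def)
  have VN: "fps_nth V N = 0" using sub by (intro nth_less_subdegree_zero) simp
  show "fps_X * fps_deriv (fps_deriv G) + of_nat (N + 2) * fps_deriv G =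
      (fps_const (1 / 4) * fps_X + fps_const \<kappa>) * G"
  proof (rule fps_ext)
    fix i
    show "fps_nth (fps_X * fps_deriv (fps_deriv G) + of_nat (N + 2) * fps_deriv G) i =
      fps_nth ((fps_const (1 / 4) * fps_X + fps_const \<kappa>) * G) i"
      using rec[of "Suc N + i"] VN
      by (cases i) (simp_all add: G_def algebra_simps fps_of_nat[symmetric])
  qed
qed

section \<open>Location of the zeros of the Pade remainder\<close>

lemma pade_no_common_root:
  assumes "n > 0" "poly (pade_P n m) z = 0" "poly (pade_Q n m) z = 0"
  shows "z = 0"
proof -
  obtain c where c: "c \<noteq> 0" "pade_P n m * (pderiv (pade_Q n m) - pade_Q n m) -
      pderiv (pade_P n m) * pade_Q n m = monom c (m + n)"
    using pade_wronskian[OF assms(1)] by blast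
  from arg_cong[OF c(2), of "\<lambda>p. poly p z"] show ?thesis
    using assms c(1) by (simp add: poly_monom)
qed

lemma fps_of_poly_of_nat: "fps_of_poly (of_nat k :: complex poly) = of_nat k"
  by (simp add: of_nat_poly fps_of_poly_const fps_of_nat)

text \<open>
  Multiplying the remainder \<open>P + exp (- z) * Q\<close> by \<open>exp (z / 2)\<close> removes the term \<open>z V'\<close> from its equation.
  It is this form that produces the factor \<open>z / 4 + \<kappa>\<close>, whose real part the energy
  argument needs to control.
\<close>

lemma pade_remainder_ode:
  fixes n m :: nat
  defines "V \<equiv> fps_exp (1 / 2) * fps_of_poly (pade_P n m) +
      fps_exp (-1 / 2) * fps_of_poly (pade_Q n m)"
  shows "fps_X * fps_deriv (fps_deriv V) - of_nat (m + n) * fps_deriv V =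
      (fps_const (1 / 4) * fps_X + fps_const ((of_nat n - of_nat m) / 2)) * V"
proof -
  define P Q where "P = fps_of_poly (pade_P n m)" and "Q = fps_of_poly (pade_Q n m)"
  define h :: "complex fps" where "h = fps_const (1 / 2)"
  define M K :: "complex fps" where "M = of_nat m" and "K = of_nat n"
  have X: "fps_of_poly [:0, 1:] = (fps_X :: complex fps)"
    by (simp add: fps_of_poly_pCons)
  have P: "fps_X * fps_deriv (fps_deriv P) = K * P - (fps_X - (M + K)) * fps_deriv P"
    using arg_cong[OF pade_P_ode[of n m], of fps_of_poly]
    by (simp only: P_def M_def K_def X fps_of_poly_mult fps_of_poly_diff fps_of_poly_add fps_of_poly_of_nat
          fps_of_poly_pderiv of_nat_add)
  have Q: "fps_X * fps_deriv (fps_deriv Q) = (fps_X + (M + K)) * fps_deriv Q - M * Q"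
    using arg_cong[OF pade_Q_ode[of n m], of fps_of_poly]
    by (simp only: Q_def M_def K_def X fps_of_poly_mult fps_of_poly_diff fps_of_poly_add
          fps_of_poly_of_nat fps_of_poly_pderiv of_nat_add)
  define e f where "e = fps_exp (1 / 2 :: complex)" and "f = fps_exp (-1 / 2 :: complex)"
  have de: "fps_deriv e = h * e" and df: "fps_deriv f = - h * f"
    by (simp_all add: e_def f_def h_def)
  have dh: "fps_deriv h = 0" by (simp add: h_def)
  have hh: "h + h = 1" "fps_const (1 / 4) = h * h"
    "fps_const ((of_nat n - of_nat m) / 2) = (K - M) * h"
    by (simp_all add: h_def K_def M_def fps_of_nat[symmetric] flip: fps_const_1_eq_1)
  have V: "V = e * P + f * Q" by (simp add: V_def e_def f_def P_def Q_def)
  have V': "fps_deriv V = e * (fps_deriv P + h * P) + f * (fps_deriv Q - h * Q)"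
    by (simp add: V de df algebra_simps)
  have V'': "fps_deriv (fps_deriv V) =
      e * (fps_deriv (fps_deriv P) + (h + h) * fps_deriv P + h * h * P) +
      f * (fps_deriv (fps_deriv Q) - (h + h) * fps_deriv Q + h * h * Q)"
    unfolding V' by (simp add: de df dh algebra_simps)
  have "fps_X * fps_deriv (fps_deriv V) =
      e * (fps_X * fps_deriv (fps_deriv P) + fps_X * fps_deriv P + fps_X * h * h * P) +
      f * (fps_X * fps_deriv (fps_deriv Q) - fps_X * fps_deriv Q + fps_X * h * h * Q)"
    unfolding V'' hh(1) by (simp add: algebra_simps)
  also have "\<dots> = (M + K) * fps_deriv V + e * ((h + h) * K * P - (M + K) * h * P + fps_X * h * h * P)
      + f * ((M + K) * h * Q - (h + h) * M * Q + fps_X * h * h * Q)"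
    unfolding P Q V' hh(1) by (simp add: algebra_simps)
  also have "\<dots> = (M + K) * fps_deriv V + (h * h * fps_X + (K - M) * h) * V"
    unfolding V by (simp add: algebra_simps)
  finally show ?thesis
    unfolding hh by (simp add: M_def K_def)
qed

text \<open>
  If the remainder vanished identically, \<open>P\<close> and \<open>exp (- z) * Q\<close> would be proportional and their
  Wronskian would be zero.
\<close>

lemma pade_remainder_nonzero:
  assumes "n > 0"
  shows "fps_exp (1 / 2) * fps_of_poly (pade_P n m) +
      fps_exp (-1 / 2) * fps_of_poly (pade_Q n m) \<noteq> 0"
proof
  define P Q where "P = fps_of_poly (pade_P n m)" and "Q = fps_of_poly (pade_Q n m)"
  assume "fps_exp (1 / 2) * fps_of_poly (pade_P n m) +
      fps_exp (-1 / 2) * fps_of_poly (pade_Q n m) = 0"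
  then have "fps_exp (1 / 2) * (fps_exp (1 / 2) * P + fps_exp (-1 / 2) * Q) = 0"
    by (simp add: P_def Q_def)
  then have "fps_exp 1 * P + Q = 0"
    by (simp add: ring_distribs mult.assoc[symmetric] fps_exp_add_mult[symmetric])
  then have Q: "Q = - (fps_exp 1 * P)" by (simp add: eq_neg_iff_add_eq_0 add.commute)
  obtain c where c: "c \<noteq> 0" "pade_P n m * (pderiv (pade_Q n m) - pade_Q n m) -
      pderiv (pade_P n m) * pade_Q n m = monom c (m + n)"
    using pade_wronskian[OF assms] by blast
  have "fps_of_poly (monom c (m + n)) = P * (fps_deriv Q - Q) - fps_deriv P * Q"
    unfolding c(2)[symmetric] P_def Q_def
    by (simp only: fps_of_poly_mult fps_of_poly_diff fps_of_poly_pderiv)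
  also have "\<dots> = 0" unfolding Q by (simp add: algebra_simps)
  finally show False using c(1) by (simp add: fps_of_poly_monom)
qed

lemma pade_root_location:
  assumes n: "n > 0" "m \<le> n" and z: "z \<noteq> 0" "poly (pade_P n m) z + exp (- z) * poly (pade_Q n m) z = 0"
  shows "m < n \<Longrightarrow> Re z < 0" and "m = n \<Longrightarrow> Re z = 0"
proof -
  define \<kappa> :: real where "\<kappa> = (real n - real m) / 2"
  define V where "V = fps_exp (1 / 2) * fps_of_poly (pade_P n m) +
      fps_exp (-1 / 2) * fps_of_poly (pade_Q n m)"
  define G where "G = fps_shift (Suc (m + n)) V"
  have "fps_nth V 0 = 0"
  proof -
    have "(-1 :: complex) ^ n = - ((-1) ^ (n - 1))"
      using n(1) by (cases n) auto
    then show ?thesis using n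
      by (simp add: V_def coeff_pade_P coeff_pade_Q)
  qed
  moreover have "fps_const (of_real \<kappa>) = fps_const ((of_nat n - of_nat m) / 2 :: complex)"
    by (simp add: \<kappa>_def)
  ultimately have VG: "V = fps_X ^ Suc (m + n) * G" and G0: "fps_nth G 0 \<noteq> 0" and
    ode: "fps_X * fps_deriv (fps_deriv G) + of_nat (m + n + 2) * fps_deriv G =
      (fps_const (1 / 4) * fps_X + fps_const (of_real \<kappa>)) * G"
    using subdegree_of_bessel_ode[of V "m + n" "of_real \<kappa>"] pade_remainder_ode[of n m]
      pade_remainder_nonzero[OF n(1), of m]
    unfolding V_def G_def by auto
  have rad: "fps_conv_radius (fps_exp c * fps_of_poly p) = \<infinity>" for c :: complex and p
    using fps_conv_radius_mult[of "fps_exp c" "fps_of_poly p"] by simp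
  have radV: "fps_conv_radius V = \<infinity>"
    using fps_conv_radius_add[of "fps_exp (1 / 2) * fps_of_poly (pade_P n m)"
        "fps_exp (-1 / 2) * fps_of_poly (pade_Q n m)"]
    by (simp add: V_def rad)
  then have radG: "fps_conv_radius G = \<infinity>" by (simp add: G_def)
  have radG': "fps_conv_radius (fps_deriv G) = \<infinity>"
    using fps_conv_radius_deriv[of G] radG by simp
  have radG'': "fps_conv_radius (fps_deriv (fps_deriv G)) = \<infinity>"
    using fps_conv_radius_deriv[of "fps_deriv G"] radG' by simp
  define g where "g = eval_fps G"
  define g' where "g' = eval_fps (fps_deriv G)"
  define g'' where "g'' = eval_fps (fps_deriv (fps_deriv G))"
  have dg: "(g has_field_derivative g' w) (at w)" for w
    unfolding g_def g'_def by (rule has_field_derivative_eval_fps) (simp add: radG)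
  have dg': "(g' has_field_derivative g'' w) (at w)" for w
    unfolding g'_def g''_def by (rule has_field_derivative_eval_fps) (simp add: radG')
  have g_ode: "w * g'' w + of_nat (m + n + 2) * g' w = (w / 4 + of_real \<kappa>) * g w" for w
  proof -
    have rX: "fps_conv_radius (fps_X * fps_deriv (fps_deriv G)) = \<infinity>"
      using fps_conv_radius_mult[of fps_X "fps_deriv (fps_deriv G)"] by (simp add: radG'')
    have rC: "fps_conv_radius (fps_const c * fps_deriv G) = \<infinity>" for c
      using fps_conv_radius_mult[of "fps_const c" "fps_deriv G"] by (simp add: radG')
    have r4: "fps_conv_radius (fps_const c * fps_X) = \<infinity>" for c :: complex
      using fps_conv_radius_mult[of "fps_const c" fps_X] by simp
    have rL: "fps_conv_radius (fps_const c * fps_X + fps_const d) = \<infinity>" for c d :: complex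
      using fps_conv_radius_add[of "fps_const c * fps_X" "fps_const d"] by (simp add: r4)
    show ?thesis
      using arg_cong[OF ode, of "\<lambda>f. eval_fps f w"]
      by (simp add: fps_of_nat[symmetric] eval_fps_add eval_fps_mult rX rC r4 rL radG radG' radG''
            g_def g'_def g''_def del: of_nat_add)
  qed
  have g0: "g 0 \<noteq> 0" using G0 by (simp add: g_def eval_fps_at_0)
  have gz: "g z = 0"
  proof -
    have "eval_fps V z = exp (z / 2) * poly (pade_P n m) z + exp (- z / 2) * poly (pade_Q n m) z"
      by (simp add: V_def eval_fps_add eval_fps_mult rad)
    also have "\<dots> = exp (z / 2) * (poly (pade_P n m) z + exp (- z) * poly (pade_Q n m) z)"
      by (simp add: ring_distribs mult.assoc[symmetric] exp_add[symmetric])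
    finally have "eval_fps V z = 0" using z(2) by simp
    moreover have "eval_fps V z = z ^ Suc (m + n) * g z"
      unfolding VG g_def by (subst eval_fps_mult) (simp_all add: radG del: power_Suc)
    ultimately show ?thesis using z(1) by simp
  qed
  have \<kappa>0: "\<kappa> \<ge> 0" using n(2) by (simp add: \<kappa>_def)
  have pos: "\<not> (Re z > 0 \<or> Re z = 0 \<and> \<kappa> > 0)"
    using zeros_of_radial_ode[OF dg dg' g_ode _ g0 gz \<kappa>0] by auto
  show "Re z < 0" if "m < n"
    using pos that by (auto simp: \<kappa>_def)
  show "Re z = 0" if "m = n"
  proof -
    have [simp]: "\<kappa> = 0" using that by (simp add: \<kappa>_def)
    \<comment> \<open>With \<open>\<kappa> = 0\<close> the function \<open>w \<mapsto> g (- w)\<close> solves the same equation and vanishes at \<open>- z\<close>.\<close>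
    have neg: "(uminus has_field_derivative -1) (at w)" for w :: complex
      by (auto intro!: derivative_eq_intros)
    have 1: "((\<lambda>w. g (- w)) has_field_derivative - g' (- w)) (at w)" for w
      using DERIV_chain2[OF dg neg, of w] by simp
    have 2: "((\<lambda>w. - g' (- w)) has_field_derivative g'' (- w)) (at w)" for w
      using DERIV_minus[OF DERIV_chain2[OF dg' neg, of w]] by simp
    have 3: "w * g'' (- w) + of_nat (m + n + 2) * (- g' (- w)) = (w / 4 + of_real 0) * g (- w)" for w
      using arg_cong[OF g_ode[of "- w"], of uminus] by (simp add: algebra_simps)
    have "\<not> Re (- z) > 0"
      using zeros_of_radial_ode[of "\<lambda>w. g (- w)" "\<lambda>w. - g' (- w)" "\<lambda>w. g'' (- w)" "m + n + 2" 0 "- z", OF 1 2 3]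
        g0 gz by auto
    then show ?thesis using pos by simp
  qed
qed

section \<open>The quasipolynomial as a Pade remainder\<close>

lemma sum_triangle_swap:
  fixes f :: "nat \<Rightarrow> nat \<Rightarrow> 'a::comm_monoid_add"
  shows "(\<Sum>k\<le>n. \<Sum>j=k..n. f k j) = (\<Sum>j\<le>n. \<Sum>k\<le>j. f k j)"
proof -
  have "(\<Sum>k\<le>n. \<Sum>j=k..n. f k j) = (\<Sum>k\<in>{..n}. \<Sum>j | j \<in> {..n} \<and> k \<le> j. f k j)"
    by (intro sum.cong) auto
  also have "\<dots> = (\<Sum>j\<in>{..n}. \<Sum>k | k \<in> {..n} \<and> k \<le> j. f k j)"
    by (rule sum.swap_restrict) auto
  also have "\<dots> = (\<Sum>j\<le>n. \<Sum>k\<le>j. f k j)"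
    by (intro sum.cong) auto
  finally show ?thesis .
qed

lemma sum_even_odd:
  fixes f :: "nat \<Rightarrow> 'a::comm_monoid_add"
  assumes "n > 0"
  shows "(\<Sum>j\<le>n. f j) = (\<Sum>l\<le>n div 2. f (2 * l)) + (\<Sum>l\<le>(n - 1) div 2. f (2 * l + 1))"
proof -
  have "{..n} = (\<lambda>l. 2 * l) ` {..n div 2} \<union> (\<lambda>l. 2 * l + 1) ` {..(n - 1) div 2}"
  proof (intro equalityI subsetI)
    fix j assume j: "j \<in> {..n}"
    show "j \<in> (\<lambda>l. 2 * l) ` {..n div 2} \<union> (\<lambda>l. 2 * l + 1) ` {..(n - 1) div 2}"
    proof (cases "even j")
      case True
      then have "j = 2 * (j div 2)" "j div 2 \<le> n div 2" using j by (auto intro: div_le_mono)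
      then show ?thesis by blast
    next
      case False
      then have "j = 2 * ((j - 1) div 2) + 1" "(j - 1) div 2 \<le> (n - 1) div 2"
        using j by (auto elim!: oddE intro!: div_le_mono)
      then show ?thesis by blast
    qed
  qed (use assms in auto)
  then have "(\<Sum>j\<le>n. f j) = sum f ((\<lambda>l. 2 * l) ` {..n div 2} \<union> (\<lambda>l. 2 * l + 1) ` {..(n - 1) div 2})"
    by simp
  also have "\<dots> = sum f ((\<lambda>l. 2 * l) ` {..n div 2}) + sum f ((\<lambda>l. 2 * l + 1) ` {..(n - 1) div 2})"
  proof (rule sum.union_disjoint)
    show "(\<lambda>l. 2 * l) ` {..n div 2} \<inter> (\<lambda>l. 2 * l + 1) ` {..(n - 1) div 2} = {}"
      by (auto simp: disjoint_iff) presburger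
  qed auto
  also have "sum f ((\<lambda>l. 2 * l) ` {..n div 2}) = (\<Sum>l\<le>n div 2. f (2 * l))"
    by (subst sum.reindex) (auto simp: inj_on_def)
  also have "sum f ((\<lambda>l. 2 * l + 1) ` {..(n - 1) div 2}) = (\<Sum>l\<le>(n - 1) div 2. f (2 * l + 1))"
    by (subst sum.reindex) (auto simp: inj_on_def)
  finally show ?thesis .
qed

lemma taylor_shift:
  fixes s s0 :: complex
  shows "(\<Sum>k\<le>j. (-1) ^ (j - k) * of_nat (j choose k) * s0 ^ (j - k) * s ^ k) = (s - s0) ^ j"
proof -
  have "(s - s0) ^ j = (s + (- s0)) ^ j" by simp
  also have "\<dots> = (\<Sum>k\<le>j. of_nat (j choose k) * s ^ k * (- s0) ^ (j - k))"
    by (rule binomial_ring)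
  also have "\<dots> = (\<Sum>k\<le>j. (-1) ^ (j - k) * of_nat (j choose k) * s0 ^ (j - k) * s ^ k)"
    by (intro sum.cong refl) (simp add: power_minus[of s0] mult_ac)
  finally show ?thesis by simp
qed

text \<open>
  Reordering the double sum by \<open>j\<close> turns each inner sum into a binomial expansion of
  \<open>(s - s0) ^ j\<close>: the prescribed \<open>a k\<close> are the coefficients, in powers of \<open>s\<close>, of a polynomial in
  \<open>s - s0\<close>. The same holds for the \<open>\<alpha> k\<close> below.
\<close>

lemma quasipolynomial_undelayed_part:
  fixes a :: "nat \<Rightarrow> real" and \<tau> s0 :: real and s :: complex
  assumes \<tau>: "\<tau> > 0" and n: "n > 0"
    and a: "\<forall>k<n. a k =
           real (n choose k) * (- s0) ^ (n - k)
           + (-1) ^ (n - k) * fact n *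
             (\<Sum>j=k..n-1. real (j choose k) * real ((m + n - j) choose m) * s0 ^ (j - k)
                            / (fact j * \<tau> ^ (n - j)))"
  shows "s ^ n + (\<Sum>k<n. of_real (a k) * s ^ k) =
     poly (pade_P n m) (of_real \<tau> * (s - of_real s0)) / of_real \<tau> ^ n"
proof -
  obtain N where N: "n = Suc N" using n by (cases n) auto
  then have n1: "n - Suc 0 = N" by simp
  define S T where "S = complex_of_real s0" and "T = complex_of_real \<tau>"
  define D where "D = s - S"
  have T: "T \<noteq> 0" using \<tau> by (simp add: T_def)
  define c where "c j = (-1) ^ (n - j) * fact n * of_nat ((m + n - j) choose m) / (fact j * T ^ (n - j))" for j
  have aS: "of_real (a k) * s ^ k =
      (-1) ^ (n - k) * of_nat (n choose k) * S ^ (n - k) * s ^ k +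
      (\<Sum>j=k..N. c j * ((-1) ^ (j - k) * of_nat (j choose k) * S ^ (j - k) * s ^ k))"
    if k: "k < n" for k
  proof -
    have sgn: "(-1) ^ (n - k) = (-1) ^ (n - j) * ((-1) ^ (j - k) :: complex)" if "j \<in> {k..N}" for j
    proof -
      have "n - k = (n - j) + (j - k)" using that N by auto
      then show ?thesis by (simp only: power_add)
    qed
    have "complex_of_real (a k) = of_nat (n choose k) * (- S) ^ (n - k) +
        (-1) ^ (n - k) * fact n *
             (\<Sum>j=k..N. of_nat (j choose k) * of_nat ((m + n - j) choose m) * S ^ (j - k)
                            / (fact j * T ^ (n - j)))"
      using a k n1 by (simp add: S_def T_def)
    then have "of_real (a k) * s ^ k = (of_nat (n choose k) * (- S) ^ (n - k) +
        (-1) ^ (n - k) * fact n *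
             (\<Sum>j=k..N. of_nat (j choose k) * of_nat ((m + n - j) choose m) * S ^ (j - k)
                            / (fact j * T ^ (n - j)))) * s ^ k"
      by (rule arg_cong)
    also have "\<dots> = (-1) ^ (n - k) * of_nat (n choose k) * S ^ (n - k) * s ^ k +
        (\<Sum>j=k..N. (-1) ^ (n - k) * (fact n * (of_nat (j choose k) * of_nat ((m + n - j) choose m) * S ^ (j - k)
                            / (fact j * T ^ (n - j))) * s ^ k))"
      by (simp add: power_minus[of S] ring_distribs sum_distrib_left sum_distrib_right mult_ac)
    also have "(\<Sum>j=k..N. (-1) ^ (n - k) * (fact n * (of_nat (j choose k) * of_nat ((m + n - j) choose m) * S ^ (j - k)
                            / (fact j * T ^ (n - j))) * s ^ k)) =
        (\<Sum>j=k..N. c j * ((-1) ^ (j - k) * of_nat (j choose k) * S ^ (j - k) * s ^ k))"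
      by (intro sum.cong refl) (simp add: sgn c_def mult_ac)
    finally show ?thesis .
  qed
  have "s ^ n + (\<Sum>k<n. of_real (a k) * s ^ k) =
      (\<Sum>k\<le>n. (-1) ^ (n - k) * of_nat (n choose k) * S ^ (n - k) * s ^ k) +
      (\<Sum>k\<le>N. \<Sum>j=k..N. c j * ((-1) ^ (j - k) * of_nat (j choose k) * S ^ (j - k) * s ^ k))"
    by (simp add: aS sum.distrib N lessThan_Suc_atMost del: sum.lessThan_Suc binomial_Suc_Suc)
  also have "\<dots> = (s - S) ^ n + (\<Sum>j\<le>N. c j * (s - S) ^ j)"
    unfolding sum_triangle_swap sum_distrib_left[symmetric] taylor_shift ..
  also have "\<dots> = (\<Sum>j\<le>n. c j * (s - S) ^ j)"
  proof -
    have "c n = 1" by (simp add: c_def)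
    then have "c (Suc N) = 1" by (simp only: N)
    then show ?thesis by (simp add: N)
  qed
  also have "\<dots> = (\<Sum>j\<le>n. coeff (pade_P n m) j * (T * (s - S)) ^ j / T ^ n)"
  proof (intro sum.cong refl)
    fix j assume j: "j \<in> {..n}"
    have "of_nat ((m + n - j) choose m) = (fact (m + n - j) / (fact m * fact (n - j)) :: complex)"
      using j by (simp add: binomial_fact)
    moreover have "T ^ n = T ^ j * T ^ (n - j)" using j by (simp flip: power_add)
    ultimately show "c j * (s - S) ^ j = coeff (pade_P n m) j * (T * (s - S)) ^ j / T ^ n"
      unfolding D_def[symmetric] using j T
      by (simp add: c_def coeff_pade_P power_mult_distrib field_simps)
  qed
  also have "\<dots> = poly (pade_P n m) (T * (s - S)) / T ^ n"
    by (simp add: poly_pade_P sum_divide_distrib)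
  finally show ?thesis by (simp add: S_def T_def)
qed

lemma quasipolynomial_delayed_part:
  fixes \<alpha> :: "nat \<Rightarrow> real" and \<tau> s0 :: real and s :: complex
  assumes \<tau>: "\<tau> > 0" and mn: "m \<le> n"
    and \<alpha>: "\<forall>k\<le>m. \<alpha> k =
           (-1) ^ (n - 1) * exp (s0 * \<tau>) *
             (\<Sum>j=k..m. (-1) ^ (j - k) * fact (m + n - j) * s0 ^ (j - k)
                          / (fact k * fact (j - k) * fact (m - j) * \<tau> ^ (n - j)))"
  shows "(\<Sum>k\<le>m. of_real (\<alpha> k) * s ^ k) =
     exp (of_real (s0 * \<tau>)) * poly (pade_Q n m) (of_real \<tau> * (s - of_real s0)) / of_real \<tau> ^ n"
proof -
  define S T E where "S = complex_of_real s0" and "T = complex_of_real \<tau>"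
    and "E = exp (complex_of_real (s0 * \<tau>))"
  define D where "D = s - S"
  have T: "T \<noteq> 0" using \<tau> by (simp add: T_def)
  define c where "c j = E * ((-1) ^ (n - 1) * fact (m + n - j)) / (fact j * fact (m - j) * T ^ (n - j))" for j
  have "of_real (\<alpha> k) * s ^ k =
      (\<Sum>j=k..m. c j * ((-1) ^ (j - k) * of_nat (j choose k) * S ^ (j - k) * s ^ k))"
    if k: "k \<le> m" for k
  proof -
    have "complex_of_real (\<alpha> k) = (-1) ^ (n - 1) * E *
             (\<Sum>j=k..m. (-1) ^ (j - k) * fact (m + n - j) * S ^ (j - k)
                          / (fact k * fact (j - k) * fact (m - j) * T ^ (n - j)))"
      using \<alpha> k by (simp add: S_def T_def E_def flip: exp_of_real)
    then have "of_real (\<alpha> k) * s ^ k = (-1) ^ (n - 1) * E *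
             (\<Sum>j=k..m. (-1) ^ (j - k) * fact (m + n - j) * S ^ (j - k)
                          / (fact k * fact (j - k) * fact (m - j) * T ^ (n - j))) * s ^ k"
      by (rule arg_cong)
    also have "\<dots> = (\<Sum>j=k..m. (-1) ^ (n - 1) * E * ((-1) ^ (j - k) * fact (m + n - j) * S ^ (j - k)
                          / (fact k * fact (j - k) * fact (m - j) * T ^ (n - j))) * s ^ k)"
      by (simp add: sum_distrib_left sum_distrib_right)
    also have "\<dots> = (\<Sum>j=k..m. c j * ((-1) ^ (j - k) * of_nat (j choose k) * S ^ (j - k) * s ^ k))"
    proof (intro sum.cong refl)
      fix j assume j: "j \<in> {k..m}"
      have "of_nat (j choose k) = (fact j / (fact k * fact (j - k)) :: complex)"
        using j by (simp add: binomial_fact)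
      then show "(-1) ^ (n - 1) * E * ((-1) ^ (j - k) * fact (m + n - j) * S ^ (j - k)
                          / (fact k * fact (j - k) * fact (m - j) * T ^ (n - j))) * s ^ k =
          c j * ((-1) ^ (j - k) * of_nat (j choose k) * S ^ (j - k) * s ^ k)"
        by (simp add: c_def mult_ac)
    qed
    finally show ?thesis .
  qed
  then have "(\<Sum>k\<le>m. of_real (\<alpha> k) * s ^ k) =
      (\<Sum>k\<le>m. \<Sum>j=k..m. c j * ((-1) ^ (j - k) * of_nat (j choose k) * S ^ (j - k) * s ^ k))"
    by (intro sum.cong) auto
  also have "\<dots> = (\<Sum>j\<le>m. c j * (s - S) ^ j)"
    unfolding sum_triangle_swap sum_distrib_left[symmetric] taylor_shift ..
  also have "\<dots> = (\<Sum>j\<le>m. E * (coeff (pade_Q n m) j * (T * (s - S)) ^ j / T ^ n))"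
  proof (intro sum.cong refl)
    fix j assume j: "j \<in> {..m}"
    have "T ^ n = T ^ j * T ^ (n - j)" using j mn by (simp flip: power_add)
    then show "c j * (s - S) ^ j = E * (coeff (pade_Q n m) j * (T * (s - S)) ^ j / T ^ n)"
      unfolding D_def[symmetric] using j T
      by (simp add: c_def coeff_pade_Q power_mult_distrib field_simps)
  qed
  also have "\<dots> = E * poly (pade_Q n m) (T * (s - S)) / T ^ n"
    by (simp add: poly_pade_Q sum_divide_distrib sum_distrib_left)
  finally show ?thesis by (simp add: S_def T_def E_def)
qed

section \<open>Rational power sums and subset sums\<close>

text \<open>
  The next two lemmas are Newton's identities in the form \<open>Y' = Y R\<close>. For
  \<open>Y = \<Prod> (1 - x t)\<close> the coefficients of \<open>Y\<close> are, up to sign, the elementary symmetric functions and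
  those of \<open>- R\<close> the power sums. Passing from \<open>Y\<close> to \<open>R\<close> requires dividing only by \<open>Y(0)\<close>, so it
  works over the integers as well as over the rationals; the set \<open>S\<close> covers both.
\<close>

lemma logarithmic_derivative_coeffs_closed:
  fixes Y R :: "complex fps"
  assumes diff: "\<And>x y. x \<in> S \<Longrightarrow> y \<in> S \<Longrightarrow> x - y \<in> S"
    and mult: "\<And>x y. x \<in> S \<Longrightarrow> y \<in> S \<Longrightarrow> x * y \<in> S"
    and nat: "\<And>n. of_nat n \<in> S"
    and Y: "\<And>k. fps_nth Y k \<in> S" "fps_nth Y 0 \<noteq> 0" "inverse (fps_nth Y 0) \<in> S"
    and eq: "fps_deriv Y = Y * R"
  shows "fps_nth R k \<in> S"
proof (induction k rule: less_induct)
  case (less k)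
  have zero: "0 \<in> S" using nat[of 0] by simp
  have add: "x + y \<in> S" if "x \<in> S" "y \<in> S" for x y
    using diff[OF that(1) diff[OF zero that(2)]] by simp
  have sum: "finite A \<Longrightarrow> (\<And>i. i \<in> A \<Longrightarrow> f i \<in> S) \<Longrightarrow> (\<Sum>i\<in>A. f i) \<in> S"
    for f :: "nat \<Rightarrow> complex" and A
    by (induction A rule: finite_induct) (auto intro: add zero)
  have "of_nat (Suc k) * fps_nth Y (Suc k) = (\<Sum>i=0..k. fps_nth Y i * fps_nth R (k - i))"
    using arg_cong[OF eq, of "\<lambda>f. fps_nth f k"] by (simp add: fps_mult_nth)
  also have "\<dots> = fps_nth Y 0 * fps_nth R k + (\<Sum>i=Suc 0..k. fps_nth Y i * fps_nth R (k - i))"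
    by (simp add: sum.atLeast_Suc_atMost)
  finally have "fps_nth R k = inverse (fps_nth Y 0) *
      (of_nat (Suc k) * fps_nth Y (Suc k) - (\<Sum>i=Suc 0..k. fps_nth Y i * fps_nth R (k - i)))"
    using Y(2) by (simp add: field_simps)
  also have "\<dots> \<in> S"
    by (intro mult diff Y nat sum less.IH) auto
  finally show ?case .
qed

text \<open>
  In this direction the recursion divides by the index of the coefficient, which is harmless over the
  rationals only.
\<close>

lemma coeffs_Rats_of_logarithmic_derivative:
  fixes Y R :: "complex fps"
  assumes Y0: "fps_nth Y 0 \<in> \<rat>" and R: "\<And>k. fps_nth R k \<in> \<rat>"
    and eq: "fps_deriv Y = Y * R"
  shows "fps_nth Y k \<in> \<rat>"
proof (induction k rule: less_induct)
  case (less k)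
  show ?case
  proof (cases k)
    case 0
    then show ?thesis using Y0 by simp
  next
    case (Suc j)
    have "of_nat (Suc j) * fps_nth Y (Suc j) = (\<Sum>i=0..j. fps_nth Y i * fps_nth R (j - i))"
      using arg_cong[OF eq, of "\<lambda>f. fps_nth f j"] by (simp add: fps_mult_nth)
    then have "fps_nth Y k = (\<Sum>i=0..j. fps_nth Y i * fps_nth R (j - i)) / of_nat (Suc j)"
      by (simp add: Suc field_simps del: of_nat_Suc)
    also have "\<dots> \<in> \<rat>"
      using Suc by (intro Rats_divide Rats_sum Rats_mult less.IH R Rats_of_nat) auto
    finally show ?thesis .
  qed
qed

lemma fps_deriv_prod_list:
  fixes f R :: "complex \<Rightarrow> complex fps"
  assumes "\<And>x. fps_deriv (f x) = f x * R x"
  shows "fps_deriv (\<Prod>x\<leftarrow>xs. f x) = (\<Prod>x\<leftarrow>xs. f x) * (\<Sum>x\<leftarrow>xs. R x)"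
  by (induction xs) (simp_all add: assms algebra_simps)

lemma fps_nth_sum_list: "fps_nth (\<Sum>x\<leftarrow>xs. f x) k = (\<Sum>x\<leftarrow>xs. fps_nth (f x) k)"
  by (induction xs) auto

lemma fps_deriv_linear_factor:
  fixes x :: complex
  shows "fps_deriv (fps_of_poly [:1, -x:]) = fps_of_poly [:1, -x:] * Abs_fps (\<lambda>k. - (x ^ Suc k))"
proof (rule fps_ext)
  fix n
  show "fps_nth (fps_deriv (fps_of_poly [:1, -x:])) n =
    fps_nth (fps_of_poly [:1, -x:] * Abs_fps (\<lambda>k. - (x ^ Suc k))) n"
    by (cases n) (simp_all add: fps_of_poly_pCons ring_distribs mult.assoc)
qed

lemma fps_of_poly_prod_list':
  "fps_of_poly (\<Prod>x\<leftarrow>xs. f x :: complex poly) = (\<Prod>x\<leftarrow>xs. fps_of_poly (f x))"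
  by (induction xs) (simp_all add: fps_of_poly_mult)

text \<open>
  The factors are written as \<open>1 - x t\<close> instead of \<open>t - x\<close> so that the product has constant
  coefficient \<open>1\<close>, and so that zero entries of the list do no harm.
\<close>

lemma newton_logarithmic_derivative:
  fixes xs :: "complex list"
  defines "Y \<equiv> fps_of_poly (\<Prod>x\<leftarrow>xs. [:1, -x:])"
  shows "fps_deriv Y = Y * Abs_fps (\<lambda>k. - (\<Sum>x\<leftarrow>xs. x ^ Suc k))"
proof -
  have "(\<Sum>x\<leftarrow>xs. Abs_fps (\<lambda>k. - (x ^ Suc k))) = Abs_fps (\<lambda>k. - (\<Sum>x\<leftarrow>xs. x ^ Suc k))"
    by (rule fps_ext) (simp add: fps_nth_sum_list uminus_sum_list_map o_def)
  then show ?thesis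
    unfolding Y_def fps_of_poly_prod_list'
    using fps_deriv_prod_list[of "\<lambda>x. fps_of_poly [:1, -x:]", OF fps_deriv_linear_factor] by simp
qed

lemma coeff_0_prod_reversed: "coeff (\<Prod>x\<leftarrow>xs. [:1, - x :: complex:]) 0 = 1"
  by (induction xs) (simp_all add: coeff_mult_0)

lemma power_sums_closed:
  fixes xs :: "complex list"
  assumes "S = \<rat> \<or> S = \<int>" and "\<And>i. coeff (\<Prod>x\<leftarrow>xs. [:1, -x:]) i \<in> S"
  shows "(\<Sum>x\<leftarrow>xs. x ^ k) \<in> S"
proof (cases k)
  case 0
  then show ?thesis using assms(1) by (auto simp: sum_list_triv)
next
  case (Suc j)
  have *: "fps_nth (Abs_fps (\<lambda>k. - (\<Sum>x\<leftarrow>xs. x ^ Suc k))) j \<in> S"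
    by (rule logarithmic_derivative_coeffs_closed[OF _ _ _ _ _ _ newton_logarithmic_derivative])
       (use assms in \<open>auto simp: coeff_0_prod_reversed\<close>)
  then have "- (\<Sum>x\<leftarrow>xs. x ^ k) \<in> S" by (simp add: Suc)
  then show ?thesis using assms(1) by (metis Ints_minus Rats_minus_iff add.inverse_inverse)
qed

lemma coeffs_Rats_of_power_sums:
  fixes xs :: "complex list"
  assumes "\<And>k. (\<Sum>x\<leftarrow>xs. x ^ k) \<in> \<rat>"
  shows "coeff (\<Prod>x\<leftarrow>xs. [:1, -x:]) i \<in> \<rat>"
proof -
  have "fps_nth (fps_of_poly (\<Prod>x\<leftarrow>xs. [:1, -x:])) i \<in> \<rat>"
    by (rule coeffs_Rats_of_logarithmic_derivative[OF _ _ newton_logarithmic_derivative])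
       (use assms[of "Suc _"] in \<open>auto simp: coeff_0_prod_reversed\<close>)
  then show ?thesis by simp
qed

fun subset_sums :: "complex list \<Rightarrow> complex list" where
  "subset_sums [] = [0]"
| "subset_sums (x # xs) = subset_sums xs @ map (\<lambda>s. x + s) (subset_sums xs)"

lemma subset_sums_generating_function:
  "(\<Prod>x\<leftarrow>xs. 1 + fps_exp x) = (\<Sum>s\<leftarrow>subset_sums xs. fps_exp s)"
  by (induction xs) (simp_all add: ring_distribs o_def fps_exp_add_mult sum_list_const_mult)

lemma prod_one_plus_exp:
  "(\<Prod>x\<leftarrow>xs. 1 + exp x) = (\<Sum>s\<leftarrow>subset_sums xs. exp s)"
  by (induction xs) (simp_all add: ring_distribs o_def exp_add sum_list_const_mult)

lemma zero_in_subset_sums: "0 \<in> set (subset_sums xs)"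
  by (induction xs) auto

text \<open>
  The subset sums enter as the exponents of \<open>\<Prod> (1 + exp (x t))\<close>. With \<open>\<phi> = exp / (1 + exp)\<close>, a
  series with rational coefficients, the logarithmic derivative of this product is the sum of
  \<open>x * \<phi> (x t)\<close>, whose coefficients are rational multiples of the power sums of the list.
\<close>

lemma subset_sums_power_sums_Rats:
  assumes "\<And>k. (\<Sum>x\<leftarrow>xs. x ^ k) \<in> \<rat>"
  shows "(\<Sum>s\<leftarrow>subset_sums xs. s ^ k) \<in> \<rat>"
proof -
  define \<phi> :: "complex fps" where "\<phi> = fps_exp 1 * inverse (1 + fps_exp 1)"
  have \<phi>: "fps_exp 1 = (1 + fps_exp 1) * \<phi>"
    by (simp add: \<phi>_def mult.left_commute inverse_mult_eq_1')
  have "1 / fact n \<in> (\<rat> :: complex set)" for n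
    by (metis Rats_1 Rats_divide Rats_of_nat of_nat_fact)
  then have rat: "fps_nth (1 + fps_exp (1::complex)) k \<in> \<rat>" for k
    by (simp add: fps_one_nth)
  have "fps_deriv (1 + fps_exp 1) = (1 + fps_exp 1) * \<phi>"
    by (subst \<phi>[symmetric]) simp
  then have "fps_nth \<phi> k \<in> \<rat>" for k
    by (rule logarithmic_derivative_coeffs_closed[of \<rat>, rotated 6]) (use rat in auto)
  define R where "R x = fps_const x * (\<phi> oo (fps_const x * fps_X))" for x
  have R: "fps_deriv (1 + fps_exp x) = (1 + fps_exp x) * R x" for x :: complex
  proof -
    have "fps_exp x = fps_exp 1 oo (fps_const x * fps_X)" by simp
    also have "\<dots> = (1 + fps_exp x) * (\<phi> oo (fps_const x * fps_X))"
      by (subst \<phi>, subst fps_compose_mult_distrib) (simp_all add: fps_compose_add_distrib)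
    finally show ?thesis by (simp add: R_def mult.left_commute)
  qed
  have "fps_nth (\<Prod>x\<leftarrow>xs. 1 + fps_exp x) k \<in> \<rat>"
  proof (rule coeffs_Rats_of_logarithmic_derivative)
    show "fps_nth (\<Prod>x\<leftarrow>xs. 1 + fps_exp x) 0 \<in> \<rat>"
      by (induction xs) auto
    show "fps_deriv (\<Prod>x\<leftarrow>xs. 1 + fps_exp x) = (\<Prod>x\<leftarrow>xs. 1 + fps_exp x) * (\<Sum>x\<leftarrow>xs. R x)"
      by (rule fps_deriv_prod_list[OF R])
    fix k
    have "fps_nth (R x) k = fps_nth \<phi> k * x ^ Suc k" for x
      unfolding R_def fps_mult_left_const_nth fps_nth_compose_linear
      by (simp only: power_Suc mult_ac)
    then have "fps_nth (\<Sum>x\<leftarrow>xs. R x) k = (\<Sum>x\<leftarrow>xs. fps_nth \<phi> k * x ^ Suc k)"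
      by (simp only: fps_nth_sum_list)
    also have "\<dots> = fps_nth \<phi> k * (\<Sum>x\<leftarrow>xs. x ^ Suc k)"
      by (rule sum_list_const_mult)
    also have "\<dots> \<in> \<rat>" by (intro Rats_mult \<open>\<And>k. fps_nth \<phi> k \<in> \<rat>\<close> assms)
    finally show "fps_nth (\<Sum>x\<leftarrow>xs. R x) k \<in> \<rat>" .
  qed
  also have "fps_nth (\<Prod>x\<leftarrow>xs. 1 + fps_exp x) k = (\<Sum>s\<leftarrow>subset_sums xs. s ^ k) / fact k"
    by (simp add: subset_sums_generating_function fps_nth_sum_list divide_inverse
          sum_list_mult_const)
  finally have "(\<Sum>s\<leftarrow>subset_sums xs. s ^ k) / fact k * fact k \<in> \<rat>"
    by (metis Rats_mult Rats_of_nat of_nat_fact)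
  then show ?thesis by simp
qed

section \<open>The method of Hermite\<close>

lemma coeffs_Ints_mult:
  fixes p q :: "complex poly"
  assumes "\<And>i. coeff p i \<in> \<int>" "\<And>i. coeff q i \<in> \<int>"
  shows "coeff (p * q) i \<in> \<int>"
  unfolding coeff_mult by (intro Ints_sum Ints_mult assms)

lemma coeffs_Ints_power:
  fixes p :: "complex poly"
  assumes "\<And>i. coeff p i \<in> \<int>"
  shows "coeff (p ^ n) i \<in> \<int>"
  by (induction n arbitrary: i) (auto intro!: coeffs_Ints_mult assms)

lemma higher_pderiv_coeff_fact:
  fixes p :: "complex poly"
  shows "coeff ((pderiv ^^ l) p) n = fact l * (of_nat ((n + l) choose l) * coeff p (n + l))"
proof -
  have "fact n * pochhammer (of_nat (Suc n) :: complex) l = fact (n + l)"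
    using pochhammer_product'[of "1::complex" n l] by (simp add: pochhammer_fact add.commute)
  also have "\<dots> = fact n * (fact l * of_nat ((n + l) choose l))"
    by (simp add: binomial_fact)
  finally show ?thesis by (simp add: coeff_higher_pderiv)
qed

lemma power_dvd_pderiv:
  fixes q p :: "complex poly"
  assumes "q ^ Suc k dvd p"
  shows "q ^ k dvd pderiv p"
proof -
  obtain r where r: "p = q ^ Suc k * r" using assms by (rule dvdE)
  have "pderiv p = q ^ Suc k * pderiv r + r * (smult (of_nat (Suc k)) (q ^ k) * pderiv q)"
    unfolding r pderiv_mult pderiv_power_Suc by (rule refl)
  also have "q ^ k dvd \<dots>"
    by (intro dvd_add dvd_mult2 dvd_mult dvd_smult dvd_refl le_imp_power_dvd) simp
  finally show ?thesis .
qed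

lemma power_dvd_higher_pderiv:
  fixes q p :: "complex poly"
  assumes "q ^ (k + l) dvd p"
  shows "q ^ k dvd (pderiv ^^ l) p"
  using assms
proof (induction l arbitrary: k)
  case (Suc l)
  have "q ^ Suc k dvd (pderiv ^^ l) p"
    by (rule Suc.IH) (use Suc.prems in simp)
  then show ?case using power_dvd_pderiv by (simp del: power_Suc)
qed simp

lemma higher_pderiv_vanishes:
  fixes F :: "complex poly"
  assumes "[:-y, 1:] ^ p dvd F" "l < p"
  shows "poly ((pderiv ^^ l) F) y = 0"
proof -
  have "[:-y, 1:] ^ (Suc (p - Suc l)) dvd (pderiv ^^ l) F"
    by (rule power_dvd_higher_pderiv) (use assms in simp)
  then have "[:-y, 1:] dvd (pderiv ^^ l) F"
    by (rule dvd_trans[rotated]) (simp only: power_Suc dvd_triv_left)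
  then show ?thesis by (simp add: poly_eq_0_iff_dvd)
qed

text \<open>
  Repeated integration by parts of \<open>exp (- u / b) * F u\<close> yields, up to sign, \<open>b * exp (- u / b)\<close> times
  this sum. The factors \<open>b ^ l\<close> come from clearing denominators: exponents are written as \<open>y / b\<close>
  with \<open>y\<close> an algebraic integer.
\<close>

definition hermite_sum :: "complex \<Rightarrow> complex poly \<Rightarrow> complex \<Rightarrow> complex" where
  "hermite_sum b F y = (\<Sum>l\<le>degree F. b ^ l * poly ((pderiv ^^ l) F) y)"

lemma hermite_sum_has_derivative:
  assumes "b \<noteq> 0"
  shows "((\<lambda>u. exp (- u / b) * hermite_sum b F u) has_field_derivative
           - (exp (- u / b) * poly F u / b)) (at u)"
proof -
  define g where "g l = b ^ l * poly ((pderiv ^^ l) F) u" for l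
  have "(pderiv ^^ Suc (degree F)) F = 0"
    by (rule poly_eqI) (simp only: coeff_higher_pderiv coeff_0, simp add: coeff_eq_0)
  then have top: "g (Suc (degree F)) = 0"
    by (simp add: g_def del: funpow.simps)
  have deriv_sum: "(hermite_sum b F has_field_derivative
      (\<Sum>l\<le>degree F. b ^ l * poly ((pderiv ^^ Suc l) F) u)) (at u)"
    unfolding hermite_sum_def by (auto intro!: DERIV_sum DERIV_cmult poly_DERIV)
  have "((\<lambda>u. exp (- u / b) * hermite_sum b F u) has_field_derivative
      - exp (- u / b) / b * hermite_sum b F u +
      (\<Sum>l\<le>degree F. b ^ l * poly ((pderiv ^^ Suc l) F) u) * exp (- u / b)) (at u)"
    using assms by (auto intro!: derivative_eq_intros deriv_sum)
  also have "(\<Sum>l\<le>degree F. b ^ l * poly ((pderiv ^^ Suc l) F) u) =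
      (\<Sum>l\<le>degree F. g (Suc l)) / b"
    unfolding sum_divide_distrib
  proof (rule sum.cong)
    show "b ^ l * poly ((pderiv ^^ Suc l) F) u = g (Suc l) / b" for l
      using assms by (simp add: g_def)
  qed simp
  also have "(\<Sum>l\<le>degree F. g (Suc l)) = hermite_sum b F u - poly F u"
  proof -
    have "(\<Sum>l\<le>Suc (degree F). g l) = g 0 + (\<Sum>l\<le>degree F. g (Suc l))"
      by (rule sum.atMost_Suc_shift)
    moreover have "(\<Sum>l\<le>Suc (degree F). g l) = hermite_sum b F u"
      using top by (simp add: hermite_sum_def g_def)
    moreover have "g 0 = poly F u" by (simp add: g_def)
    ultimately show ?thesis by (simp del: sum.atMost_Suc)
  qed
  also have "- exp (- u / b) / b * hermite_sum b F u +
      (hermite_sum b F u - poly F u) / b * exp (- u / b) = - (exp (- u / b) * poly F u / b)"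
    using assms by (simp add: field_simps)
  finally show ?thesis .
qed

lemma reflect_linear_factor: "reflect_poly [:-x, 1:] = [:1, -x :: complex:]"
  by (cases "x = 0") (simp_all add: reflect_poly_def)

lemma coeffs_Ints_of_reversed:
  fixes gs :: "complex list"
  assumes "\<And>i. coeff (\<Prod>x\<leftarrow>gs. [:1, -x:]) i \<in> \<int>"
  shows "coeff (\<Prod>x\<leftarrow>gs. [:-x, 1:]) i \<in> \<int>"
proof -
  define G where "G = (\<Prod>x\<leftarrow>gs. [:-x, 1:])"
  have R: "reflect_poly G = (\<Prod>x\<leftarrow>gs. [:1, -x:])"
    by (simp add: G_def reflect_poly_prod_list o_def reflect_linear_factor)
  show ?thesis
  proof (cases "i \<le> degree G")
    case True
    have "coeff (reflect_poly G) (degree G - i) = coeff G i"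
      using True by (simp add: coeff_reflect_poly)
    then show ?thesis using assms[of "degree G - i"] R by (simp add: G_def)
  next
    case False
    then have "coeff G i = 0" by (simp add: coeff_eq_0)
    then show ?thesis by (simp add: G_def)
  qed
qed

text \<open>
  Divisibility half of Hermite's method, with \<open>F = t ^ (p - 1) * G ^ p\<close>. At a root of \<open>G\<close> only derivatives
  of order at least \<open>p\<close> survive, and these contribute multiples of \<open>p!\<close>; at \<open>0\<close> there is one more
  surviving term, of order \<open>p - 1\<close>, and it carries only \<open>(p - 1)!\<close>. Summing over all roots makes
  the contributions integers, since power sums of the roots are integers.
\<close>

lemma hermite_identity:
  fixes gs :: "complex list" and b k :: nat
  assumes int: "\<And>i. coeff (\<Prod>x\<leftarrow>gs. [:1, -x:]) i \<in> \<int>"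
    and p: "p > 0"
  defines "G \<equiv> \<Prod>x\<leftarrow>gs. [:-x, 1:]"
  defines "A \<equiv> hermite_sum (of_nat b) (monom 1 (p - 1) * G ^ p)"
  obtains z where "z \<in> \<int>"
    "of_nat k * A 0 + (\<Sum>y\<leftarrow>gs. A y) =
       fact (p - 1) * (of_nat (k * b ^ (p - 1)) * coeff G 0 ^ p + of_nat p * z)"
proof -
  define F where "F = monom 1 (p - 1) * G ^ p"
  define H where "H l = smult (1 / fact l) ((pderiv ^^ l) F)" for l
  define M where "M = degree F"
  have G: "coeff G i \<in> \<int>" for i
    unfolding G_def by (rule coeffs_Ints_of_reversed[OF int])
  have F: "coeff F i \<in> \<int>" for i
    unfolding F_def by (intro coeffs_Ints_mult coeffs_Ints_power G) simp
  have H: "coeff (H l) i \<in> \<int>" for l i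
    by (simp add: H_def higher_pderiv_coeff_fact F Ints_mult)
  have D: "(pderiv ^^ l) F = smult (fact l) (H l)" for l
    by (simp add: H_def)
  have sum_H: "(\<Sum>y\<leftarrow>gs. poly (H l) y) \<in> \<int>" for l
  proof -
    have "(\<Sum>y\<leftarrow>gs. poly (H l) y) =
        (\<Sum>i\<le>degree (H l). coeff (H l) i * (\<Sum>y\<leftarrow>gs. y ^ i))"
      unfolding poly_altdef
      by (induction gs) (simp_all add: sum.distrib ring_distribs)
    also have "\<dots> \<in> \<int>"
      by (intro Ints_sum Ints_mult H power_sums_closed int) simp
    finally show ?thesis .
  qed
  define c where "c l = of_nat b ^ l * (of_nat (fact l div fact p) :: complex)" for l
  have c: "of_nat b ^ l * fact l = fact p * c l" if "p \<le> l" for l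
  proof -
    have "fact p * (fact l div fact p) = (fact l :: nat)"
      using that by (simp add: fact_dvd)
    then have "fact p * of_nat (fact l div fact p) = (fact l :: complex)"
      by (metis of_nat_fact of_nat_mult)
    then show ?thesis by (simp add: c_def mult.left_commute)
  qed
  have cI: "c l \<in> \<int>" for l by (simp add: c_def)
  have A: "A y = (\<Sum>l\<le>M. of_nat b ^ l * (fact l * poly (H l) y))" for y
    by (simp add: A_def hermite_sum_def M_def D F_def[symmetric] del: One_nat_def)
  \<comment> \<open>The second premise covers \<open>M < p - 1\<close>, so that the degree of \<open>F\<close> need not be computed.\<close>
  have split: "(\<Sum>l\<le>M. f l) = f (p - 1) + (\<Sum>l\<in>{p..M}. f l)"
    if "\<And>l. l < p - 1 \<Longrightarrow> f l = 0" "M < p - 1 \<Longrightarrow> f (p - 1) = 0" for f :: "nat \<Rightarrow> complex"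
  proof -
    have "(\<Sum>l\<le>M. f l) = (\<Sum>l\<in>insert (p - 1) {p..M}. f l)"
    proof (rule sum.mono_neutral_cong)
      show "f i = 0" if "i \<in> insert (p - 1) {p..M} - {..M}" for i
        using that \<open>M < p - 1 \<Longrightarrow> f (p - 1) = 0\<close> by auto
      show "f i = 0" if "i \<in> {..M} - insert (p - 1) {p..M}" for i
        using that by (intro \<open>\<And>l. l < p - 1 \<Longrightarrow> f l = 0\<close>) auto
    qed auto
    then show ?thesis using p by simp
  qed
  have H0: "poly (H l) 0 = coeff F l" for l
    unfolding poly_0_coeff_0 H_def coeff_smult higher_pderiv_coeff_fact by simp
  have "A 0 = of_nat b ^ (p - 1) * (fact (p - 1) * coeff F (p - 1))
      + (\<Sum>l\<in>{p..M}. of_nat b ^ l * (fact l * coeff F l))"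
  proof -
    have "A 0 = (\<Sum>l\<le>M. of_nat b ^ l * (fact l * coeff F l))"
      by (simp only: A H0)
    also have "\<dots> = of_nat b ^ (p - 1) * (fact (p - 1) * coeff F (p - 1))
        + (\<Sum>l\<in>{p..M}. of_nat b ^ l * (fact l * coeff F l))"
    proof (rule split)
      show "of_nat b ^ l * (fact l * coeff F l) = 0" if "l < p - 1" for l
        using that by (simp add: F_def coeff_monom_mult)
      show "of_nat b ^ (p - 1) * (fact (p - 1) * coeff F (p - 1)) = 0" if "M < p - 1"
        using that by (simp add: M_def coeff_eq_0)
    qed
    finally show ?thesis .
  qed
  also have "coeff F (p - 1) = coeff G 0 ^ p"
    by (simp add: F_def coeff_monom_mult coeff_0_power)
  also have "(\<Sum>l\<in>{p..M}. of_nat b ^ l * (fact l * coeff F l)) =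
      fact p * (\<Sum>l\<in>{p..M}. c l * coeff F l)"
    by (simp add: sum_distrib_left c mult.assoc[symmetric])
  finally have A0: "A 0 = of_nat b ^ (p - 1) * (fact (p - 1) * coeff G 0 ^ p)
      + fact p * (\<Sum>l\<in>{p..M}. c l * coeff F l)" .
  have Ay: "A y = fact p * (\<Sum>l\<in>{p..M}. c l * poly (H l) y)" if y: "y \<in> set gs" for y
  proof -
    have "poly G y = 0"
      unfolding G_def using y by (induction gs) auto
    then have "[:-y, 1:] dvd G" by (simp add: poly_eq_0_iff_dvd)
    then have "[:-y, 1:] ^ p dvd F"
      unfolding F_def by (intro dvd_mult dvd_power_same)
    then have van: "poly (H l) y = 0" if "l < p" for l
      using higher_pderiv_vanishes that by (simp add: H_def)
    have "A y = of_nat b ^ (p - 1) * (fact (p - 1) * poly (H (p - 1)) y)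
      + (\<Sum>l\<in>{p..M}. of_nat b ^ l * (fact l * poly (H l) y))"
      unfolding A by (rule split) (simp_all add: van p)
    then show ?thesis using van[of "p - 1"] p
      by (simp add: sum_distrib_left c mult.assoc[symmetric])
  qed
  have "(\<Sum>y\<leftarrow>gs. A y) = (\<Sum>y\<leftarrow>gs. fact p * (\<Sum>l\<in>{p..M}. c l * poly (H l) y))"
    by (intro arg_cong[of _ _ sum_list] map_cong refl Ay)
  also have "\<dots> = fact p * (\<Sum>l\<in>{p..M}. c l * (\<Sum>y\<leftarrow>gs. poly (H l) y))"
    by (induction gs) (simp_all add: sum.distrib ring_distribs)
  finally have sumA: "(\<Sum>y\<leftarrow>gs. A y) =
      fact p * (\<Sum>l\<in>{p..M}. c l * (\<Sum>y\<leftarrow>gs. poly (H l) y))" .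
  define S0 where "S0 = (\<Sum>l\<in>{p..M}. c l * coeff F l)"
  define S1 where "S1 = (\<Sum>l\<in>{p..M}. c l * (\<Sum>y\<leftarrow>gs. poly (H l) y))"
  define z where "z = of_nat k * S0 + S1"
  have "fact p = of_nat p * (fact (p - 1) :: complex)"
    using p by (rule fact_reduce)
  then have "of_nat k * A 0 + (\<Sum>y\<leftarrow>gs. A y) =
       fact (p - 1) * (of_nat (k * b ^ (p - 1)) * coeff G 0 ^ p + of_nat p * z)"
    unfolding A0 sumA z_def S0_def[symmetric] S1_def[symmetric] of_nat_mult of_nat_power
    by (simp only: ring_distribs ac_simps)
  moreover have "z \<in> \<int>"
    unfolding z_def S0_def S1_def by (intro Ints_add Ints_mult Ints_sum cI F sum_H Ints_of_nat)
  ultimately show ?thesis using that by blast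
qed

text \<open>
  Size half of Hermite's method: by the mean value inequality the difference
  \<open>exp (y / b) * A 0 - A y\<close> is controlled by the values of \<open>F\<close> on a disc of fixed radius \<open>R\<close>, and these grow
  only geometrically in \<open>p\<close>, in contrast to the factor \<open>(p - 1)!\<close>.
\<close>

lemma hermite_bound:
  fixes gs :: "complex list" and b :: nat
  assumes b: "b > 0"
  defines "G \<equiv> \<Prod>x\<leftarrow>gs. [:-x, 1:]"
  obtains C K :: real where "\<And>p. p > 0 \<Longrightarrow>
      norm ((\<Sum>y\<leftarrow>gs. exp (y / of_nat b)) * hermite_sum (of_nat b) (monom 1 (p - 1) * G ^ p) 0
            - (\<Sum>y\<leftarrow>gs. hermite_sum (of_nat b) (monom 1 (p - 1) * G ^ p) y)) \<le> C * K ^ p"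
proof -
  define R where "R = 1 + (\<Sum>y\<leftarrow>gs. norm y)"
  have R1: "R \<ge> 1" by (auto simp: R_def intro!: sum_list_nonneg)
  have R: "norm y \<le> R" if "y \<in> set gs" for y
    using member_le_sum_list[of "norm y" "map norm gs"] that unfolding R_def by fastforce
  define K where "K = R * (2 * R) ^ length gs"
  define C where "C = length gs * (exp R * (exp R * R))"
  have K: "K > 0" using R1 by (simp add: K_def)
  have expb: "norm (exp (u / of_nat b)) \<le> exp R" if "norm u \<le> R" for u :: complex
  proof -
    have "norm (u / of_nat b) \<le> norm u / 1"
      unfolding norm_divide norm_of_nat using b by (intro divide_left_mono) auto
    then have "exp (norm (u / of_nat b)) \<le> exp R" using that by simp
    then show ?thesis using norm_exp[of "u / of_nat b"] by (rule order_trans[rotated])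
  qed
  show ?thesis
  proof (rule that)
    fix p :: nat assume p: "p > 0"
    define F where "F = monom 1 (p - 1) * G ^ p"
    define A where "A = hermite_sum (of_nat b) F"
    have polyG: "norm (poly G u) \<le> (2 * R) ^ length gs" if u: "norm u \<le> R" for u
    proof -
      have "norm (\<Prod>x\<leftarrow>ys. u - x) \<le> (2 * R) ^ length ys" if "set ys \<subseteq> set gs" for ys
        using that
      proof (induction ys)
        case (Cons x ys)
        have "norm (u - x) \<le> 2 * R"
          using norm_triangle_ineq4[of u x] u R[of x] Cons.prems by simp
        then show ?case using Cons R1 by (auto simp: norm_mult intro!: mult_mono)
      qed simp
      moreover have "poly G u = (\<Prod>x\<leftarrow>gs. u - x)"
        unfolding G_def by (induction gs) (auto simp: algebra_simps)
      ultimately show ?thesis by simp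
    qed
    have polyF: "norm (poly F u) \<le> K ^ p" if u: "norm u \<le> R" for u
    proof -
      have "norm (poly F u) = norm u ^ (p - 1) * norm (poly G u) ^ p"
        by (simp add: F_def poly_monom norm_mult norm_power)
      also have "\<dots> \<le> R ^ (p - 1) * ((2 * R) ^ length gs) ^ p"
        using u R1 polyG[OF u] by (intro mult_mono power_mono) auto
      also have "\<dots> \<le> R ^ p * ((2 * R) ^ length gs) ^ p"
        using R1 by (intro mult_right_mono power_increasing) auto
      finally show ?thesis by (simp add: K_def power_mult_distrib)
    qed
    have one: "norm (exp (y / of_nat b) * A 0 - A y) \<le> exp R * (exp R * K ^ p * R)"
      if y: "y \<in> set gs" for y
    proof -
      define \<phi> where "\<phi> u = exp (- u / of_nat b) * A u" for u
      have "norm (\<phi> y - \<phi> 0) \<le> (exp R * K ^ p) * norm (y - 0)"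
      proof (rule field_differentiable_bound[of "cball 0 R" _ _ _ y 0])
        fix u :: complex assume u: "u \<in> cball 0 R"
        show "(\<phi> has_field_derivative - (exp (- u / of_nat b) * poly F u / of_nat b))
            (at u within cball 0 R)"
          unfolding \<phi>_def A_def
          by (rule has_field_derivative_at_within, rule hermite_sum_has_derivative) (use b in simp)
        have "norm (- (exp (- u / of_nat b) * poly F u / of_nat b)) \<le>
            exp R * K ^ p / of_nat b"
          unfolding norm_minus_cancel norm_divide norm_mult norm_of_nat
          using u by (intro divide_right_mono mult_mono expb polyF) auto
        also have "\<dots> \<le> exp R * K ^ p / 1"
          using b K by (intro divide_left_mono) auto
        finally show "norm (- (exp (- u / of_nat b) * poly F u / of_nat b)) \<le> exp R * K ^ p"
          by simp
      qed (use R[OF y] R1 in auto)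
      also have "\<dots> \<le> exp R * K ^ p * R"
        using R[OF y] K by (intro mult_left_mono) auto
      finally have *: "norm (\<phi> y - \<phi> 0) \<le> exp R * K ^ p * R" .
      have "exp (y / of_nat b) * A 0 - A y = - (exp (y / of_nat b) * (\<phi> y - \<phi> 0))"
        by (simp add: \<phi>_def exp_minus field_simps)
      then have "norm (exp (y / of_nat b) * A 0 - A y) =
          norm (exp (y / of_nat b)) * norm (\<phi> y - \<phi> 0)"
        by (simp add: norm_mult)
      also have "\<dots> \<le> exp R * (exp R * K ^ p * R)"
        by (intro mult_mono expb R y *) auto
      finally show ?thesis .
    qed
    have "norm ((\<Sum>y\<leftarrow>ys. exp (y / of_nat b)) * A 0 - (\<Sum>y\<leftarrow>ys. A y))
        \<le> length ys * (exp R * (exp R * K ^ p * R))" if "set ys \<subseteq> set gs" for ys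
      using that
    proof (induction ys)
      case (Cons y ys)
      have "norm ((\<Sum>y\<leftarrow>y # ys. exp (y / of_nat b)) * A 0 - (\<Sum>y\<leftarrow>y # ys. A y)) =
        norm ((exp (y / of_nat b) * A 0 - A y) +
          ((\<Sum>y\<leftarrow>ys. exp (y / of_nat b)) * A 0 - (\<Sum>y\<leftarrow>ys. A y)))"
        by (simp add: algebra_simps)
      also have "\<dots> \<le> exp R * (exp R * K ^ p * R) + length ys * (exp R * (exp R * K ^ p * R))"
        using Cons by (intro norm_triangle_mono one) auto
      finally show ?case by (simp add: algebra_simps)
    qed simp
    from this[of gs]
    show "norm ((\<Sum>y\<leftarrow>gs. exp (y / of_nat b)) * hermite_sum (of_nat b) (monom 1 (p - 1) * G ^ p) 0
            - (\<Sum>y\<leftarrow>gs. hermite_sum (of_nat b) (monom 1 (p - 1) * G ^ p) y)) \<le> C * K ^ p"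
      by (simp add: A_def F_def C_def mult_ac)
  qed
qed

text \<open>
  Hermite's contradiction: if the sum were zero, the integer of \<open>hermite_identity\<close> would be divisible by
  \<open>(p - 1)!\<close>, bounded by \<open>C * K ^ p\<close>, and nonzero for large primes \<open>p\<close>.
\<close>

lemma hermite_nonvanishing:
  fixes gs :: "complex list" and b k :: nat
  assumes int: "\<And>i. coeff (\<Prod>x\<leftarrow>gs. [:1, -x:]) i \<in> \<int>"
    and b: "b > 0" and k: "k > 0" and nz: "0 \<notin> set gs"
  shows "of_nat k + (\<Sum>y\<leftarrow>gs. exp (y / of_nat b)) \<noteq> 0"
proof
  assume zero: "of_nat k + (\<Sum>y\<leftarrow>gs. exp (y / of_nat b)) = 0"
  define G where "G = (\<Prod>x\<leftarrow>gs. [:-x, 1:])"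
  obtain C K :: real where bound: "\<And>p. p > 0 \<Longrightarrow>
      norm ((\<Sum>y\<leftarrow>gs. exp (y / of_nat b)) * hermite_sum (of_nat b) (monom 1 (p - 1) * G ^ p) 0
            - (\<Sum>y\<leftarrow>gs. hermite_sum (of_nat b) (monom 1 (p - 1) * G ^ p) y)) \<le> C * K ^ p"
    using hermite_bound[OF b, of gs] unfolding G_def by blast
  obtain g where g: "coeff G 0 = of_int g"
    using coeffs_Ints_of_reversed[OF int, of 0] unfolding G_def by (elim Ints_cases)
  have "coeff G 0 \<noteq> 0"
    unfolding G_def poly_0_coeff_0[symmetric] using nz by (induction gs) auto
  then have g0: "g \<noteq> 0" using g by auto
  have "(\<lambda>q. C * K * (K ^ q /\<^sub>R fact q)) \<longlonglongrightarrow> C * K * 0"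
    by (intro tendsto_intros summable_LIMSEQ_zero summable_exp_generic)
  then have "\<forall>\<^sub>F q in sequentially. C * K * (K ^ q /\<^sub>R fact q) < 1"
    by (intro order_tendstoD(2)) auto
  then obtain q0 where q0: "\<And>q. q \<ge> q0 \<Longrightarrow> C * K * (K ^ q /\<^sub>R fact q) < 1"
    unfolding eventually_sequentially by blast
  obtain p where p: "prime p" "p > q0 + k + b + nat \<bar>g\<bar> + 1"
    using bigger_prime by blast
  have p0: "p > 0" using p(1) by (rule prime_gt_0_nat)
  obtain z where z: "z \<in> \<int>" and eq:
    "of_nat k * hermite_sum (of_nat b) (monom 1 (p - 1) * G ^ p) 0 +
      (\<Sum>y\<leftarrow>gs. hermite_sum (of_nat b) (monom 1 (p - 1) * G ^ p) y) =
       fact (p - 1) * (of_nat (k * b ^ (p - 1)) * coeff G 0 ^ p + of_nat p * z)"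
    unfolding G_def by (rule hermite_identity[OF int p0, of k b])
  obtain z' where z': "z = of_int z'" using z by (elim Ints_cases)
  define w :: int where "w = int (k * b ^ (p - 1)) * g ^ p + int p * z'"
  \<comment> \<open>A prime exceeding \<open>k\<close>, \<open>b\<close> and \<open>\<bar>g\<bar>\<close> keeps the first summand of \<open>w\<close> prime to \<open>p\<close>.\<close>
  have "\<not> int p dvd int k" "\<not> int p dvd int b" "\<not> int p dvd \<bar>g\<bar>"
    by (rule zdvd_not_zless; use p k b g0 in linarith)+
  then have "\<not> int p dvd int k" "\<not> int p dvd int b" "\<not> int p dvd g"
    by simp_all
  moreover have "prime (int p)" using p by simp
  ultimately have "\<not> int p dvd int (k * b ^ (p - 1)) * g ^ p"
    by (metis int_dvd_int_iff of_nat_mult of_nat_power prime_dvd_mult_iff prime_dvd_power)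
  then have "\<not> int p dvd w"
    unfolding w_def by (simp add: dvd_add_left_iff)
  then have "w \<noteq> 0" by auto
  then have "1 \<le> norm (of_int w :: complex)" by simp
  then have "fact (p - 1) \<le> fact (p - 1) * norm (of_int w :: complex)" by simp
  also have "\<dots> = norm (fact (p - 1) * of_int w :: complex)"
    by (simp add: norm_mult)
  also have "fact (p - 1) * of_int w = 
      of_nat k * hermite_sum (of_nat b) (monom 1 (p - 1) * G ^ p) 0 +
      (\<Sum>y\<leftarrow>gs. hermite_sum (of_nat b) (monom 1 (p - 1) * G ^ p) y)"
    unfolding eq by (simp add: w_def g z')
  also have "of_nat k = - (\<Sum>y\<leftarrow>gs. exp (y / of_nat b))"
    using zero by (simp add: add_eq_0_iff2)
  also have "norm (- (\<Sum>y\<leftarrow>gs. exp (y / of_nat b)) *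
        hermite_sum (of_nat b) (monom 1 (p - 1) * G ^ p) 0 +
      (\<Sum>y\<leftarrow>gs. hermite_sum (of_nat b) (monom 1 (p - 1) * G ^ p) y)) \<le> C * K ^ p"
    using bound[OF p0] by (subst (asm) norm_minus_commute) (simp add: algebra_simps)
  also have "C * K ^ p = C * K * K ^ (p - 1)"
    using p0 by (simp add: power_eq_if)
  finally have "1 \<le> C * K * (K ^ (p - 1) /\<^sub>R fact (p - 1))"
    by (simp add: field_simps)
  moreover have "q0 \<le> p - 1" using p by linarith
  ultimately show False using q0[of "p - 1"] by linarith
qed

section \<open>Transcendence of logarithms of minus one\<close>

lemma coeff_prod_reversed_scaled:
  "coeff (\<Prod>x\<leftarrow>xs. [:1, -(c * x :: complex):]) i = c ^ i * coeff (\<Prod>x\<leftarrow>xs. [:1, -x:]) i"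
proof (induction xs arbitrary: i)
  case Nil
  then show ?case by (cases i) auto
next
  case (Cons x xs)
  then show ?case by (cases i) (simp_all add: algebra_simps)
qed

lemma common_denominator:
  fixes p :: "complex poly"
  assumes "\<And>i. coeff p i \<in> \<rat>"
  obtains b :: nat where "b > 0" "\<And>i. of_nat b * coeff p i \<in> \<int>"
proof -
  have "\<exists>d::nat. d > 0 \<and> of_nat d * coeff p i \<in> \<int>" for i
  proof -
    obtain m :: int and d where "d > 0" "coeff p i = of_int m / of_int d"
      using assms[of i] by (elim Rats_cases')
    then have "nat d > 0 \<and> of_nat (nat d) * coeff p i \<in> \<int>" by simp
    then show ?thesis by blast
  qed
  then obtain d :: "nat \<Rightarrow> nat" where d: "\<And>i. d i > 0" "\<And>i. of_nat (d i) * coeff p i \<in> \<int>"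
    by metis
  define b where "b = (\<Prod>i\<le>degree p. d i)"
  have "of_nat b * coeff p i \<in> \<int>" for i
  proof (cases "i \<le> degree p")
    case True
    then have "b = d i * (\<Prod>j\<in>{..degree p} - {i}. d j)"
      by (simp add: b_def prod.remove)
    then have "of_nat b * coeff p i =
        of_nat (\<Prod>j\<in>{..degree p} - {i}. d j) * (of_nat (d i) * coeff p i)"
      by simp
    also have "\<dots> \<in> \<int>" by (intro Ints_mult d Ints_of_nat)
    finally show ?thesis .
  next
    case False
    then show ?thesis by (simp add: coeff_eq_0)
  qed
  moreover have "b > 0" using d(1) by (simp add: b_def prod_pos)
  ultimately show ?thesis using that by blast
qed

text \<open>
  Multiply \<open>1 + exp x\<close> over all roots \<open>x\<close> of an integer polynomial that vanishes at \<open>z\<close>.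
  The product is zero if \<open>exp z = -1\<close>, and expanding it gives a sum of exponentials of subset sums. Those subset sums that are zero, among
  them the empty one, contribute a positive integer \<open>k\<close>, and the others form a list with rational power
  sums; this is the situation excluded by \<open>hermite_nonvanishing\<close>.
\<close>

theorem algebraic_imp_exp_neq_minus_one:
  fixes z :: complex
  assumes "algebraic z"
  shows "exp z \<noteq> -1"
proof
  assume z: "exp z = -1"
  obtain p where p: "\<And>i. coeff p i \<in> \<int>" "p \<noteq> 0" "poly p z = 0"
    using assms unfolding algebraic_def by blast
  obtain xs where xs: "mset xs = proots p" using ex_mset by blast
  define G where "G = (\<Prod>x\<leftarrow>xs. [:-x, 1:])"
  have G: "p = smult (lead_coeff p) G"
    using complex_poly_decompose_multiset[of p] unfolding G_def
    by (metis mset_map prod_mset_prod_list xs)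
  have z_root: "z \<in> set xs"
    using p xs by (metis (mono_tags) set_count_proots set_mset_mset mem_Collect_eq)
  have "coeff G i \<in> \<rat>" for i
  proof -
    have "coeff G i = coeff p i / lead_coeff p"
      using p(2) by (subst G) simp
    also have "\<dots> \<in> \<rat>" using p(1) Ints_subset_Rats by (blast intro: Rats_divide)
    finally show ?thesis .
  qed
  moreover have "reflect_poly G = (\<Prod>x\<leftarrow>xs. [:1, -x:])"
    by (simp add: G_def reflect_poly_prod_list o_def reflect_linear_factor)
  ultimately have "coeff (\<Prod>x\<leftarrow>xs. [:1, -x:]) i \<in> \<rat>" for i
    by (metis coeff_reflect_poly Rats_0)
  then have "(\<Sum>x\<leftarrow>xs. x ^ k) \<in> \<rat>" for k
    by (intro power_sums_closed) auto
  then have power_sums: "(\<Sum>s\<leftarrow>subset_sums xs. s ^ k) \<in> \<rat>" for k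
    by (rule subset_sums_power_sums_Rats)
  define \<beta> where "\<beta> = filter (\<lambda>s. s \<noteq> 0) (subset_sums xs)"
  have "(\<Sum>s\<leftarrow>\<beta>. s ^ k) \<in> \<rat>" for k
  proof (cases k)
    case 0
    then show ?thesis by (simp add: sum_list_triv)
  next
    case (Suc j)
    have "(\<Sum>s\<leftarrow>filter (\<lambda>s. s \<noteq> 0) ss. s ^ Suc j) = (\<Sum>s\<leftarrow>ss. s ^ Suc j)" for ss :: "complex list"
      by (induction ss) auto
    then show ?thesis using power_sums[of k] by (simp only: Suc \<beta>_def)
  qed
  then have B: "coeff (\<Prod>x\<leftarrow>\<beta>. [:1, -x:]) i \<in> \<rat>" for i
    by (rule coeffs_Rats_of_power_sums)
  obtain b :: nat where b: "b > 0" "\<And>i. of_nat b * coeff (\<Prod>x\<leftarrow>\<beta>. [:1, -x:]) i \<in> \<int>"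
    using common_denominator[OF B] by blast
  \<comment> \<open>Scaling by the common denominator turns the exponents into algebraic integers.\<close>
  define gs where "gs = map (\<lambda>x. of_nat b * x) \<beta>"
  have int: "coeff (\<Prod>x\<leftarrow>gs. [:1, -x:]) i \<in> \<int>" for i
  proof -
    have eq: "coeff (\<Prod>x\<leftarrow>gs. [:1, -x:]) i = of_nat b ^ i * coeff (\<Prod>x\<leftarrow>\<beta>. [:1, -x:]) i"
      by (simp only: gs_def map_map o_def coeff_prod_reversed_scaled)
    show ?thesis
    proof (cases i)
      case 0
      then show ?thesis by (simp add: coeff_0_prod_reversed)
    next
      case (Suc j)
      have "of_nat b ^ j * (of_nat b * coeff (\<Prod>x\<leftarrow>\<beta>. [:1, -x:]) i) \<in> \<int>"
        by (intro Ints_mult b Ints_power Ints_of_nat)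
      then show ?thesis unfolding eq by (simp add: Suc mult_ac)
    qed
  qed
  define k where "k = length (filter (\<lambda>s. s = 0) (subset_sums xs))"
  have k: "k > 0"
    using zero_in_subset_sums[of xs] by (auto simp: k_def filter_empty_conv)
  have "0 \<notin> set gs" using b(1) by (auto simp: gs_def \<beta>_def)
  then have nonzero: "of_nat k + (\<Sum>y\<leftarrow>gs. exp (y / of_nat b)) \<noteq> 0"
    by (rule hermite_nonvanishing[OF int b(1) k])
  have "(\<Sum>s\<leftarrow>ss. exp s) = of_nat (length (filter (\<lambda>s. s = 0) ss)) +
      (\<Sum>s\<leftarrow>filter (\<lambda>s. s \<noteq> 0) ss. exp s)" for ss :: "complex list"
    by (induction ss) auto
  then have "(\<Sum>s\<leftarrow>subset_sums xs. exp s) = of_nat k + (\<Sum>s\<leftarrow>\<beta>. exp s)"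
    unfolding k_def \<beta>_def .
  then have "(\<Prod>x\<leftarrow>xs. 1 + exp x) = of_nat k + (\<Sum>s\<leftarrow>\<beta>. exp s)"
    unfolding prod_one_plus_exp .
  moreover have "(\<Sum>y\<leftarrow>gs. exp (y / of_nat b)) = (\<Sum>s\<leftarrow>\<beta>. exp s)"
    unfolding gs_def map_map o_def using b(1) by (simp only: nonzero_mult_div_cancel_left of_nat_eq_0_iff)
  moreover have "(\<Prod>x\<leftarrow>xs. 1 + exp x) = 0"
    using z_root by (induction xs) (auto simp: z)
  ultimately show False using nonzero by simp
qed

section \<open>Purely imaginary zeros in the neutral case\<close>

text \<open>
  Even powers of \<open>\<i> \<zeta>\<close> are real and give the denominator in the definition of \<open>Xi\<close>, odd powers are
  imaginary and give the numerator.
\<close>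

lemma pade_diagonal_imaginary:
  assumes n: "n > 0"
  shows "(\<Sum>j\<le>n. fact (n + n - j) / (fact j * fact (n - j)) * (\<i> * complex_of_real \<zeta>) ^ j) =
    of_real (Xi_den n \<zeta>) + \<i> * of_real (Xi_num n \<zeta>)"
proof -
  have pow: "(\<i> * x) ^ (2 * l) = (-1) ^ l * x ^ (2 * l)"
    "(\<i> * x) ^ (2 * l + 1) = \<i> * x * ((-1) ^ l * x ^ (2 * l))" for l and x :: complex
    by (simp_all add: power_mult_distrib power_mult power_add power_minus[of "x\<^sup>2"])
  have e1: "2 * n - 2 * l - 1 = n + n - (2 * l + 1)" "n - 2 * l - 1 = n - (2 * l + 1)" 
    "2 * n - 2 * l = n + n - 2 * l" for l by simp_all
  show ?thesis
    unfolding sum_even_odd[OF n] pow Xi_den_def Xi_num_def e1(1,2)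
    unfolding e1(3) of_real_mult of_real_sum of_real_power sum_distrib_left
    by (intro arg_cong2[of _ _ _ _ "(+)"] sum.cong refl)
       (simp_all only: of_real_divide of_real_mult of_real_fact of_real_power of_real_minus of_real_1
          times_divide_eq_left times_divide_eq_right mult_ac)
qed

lemma Xi_den_minus: "Xi_den n (- \<zeta>) = Xi_den n \<zeta>"
  by (simp add: Xi_den_def)

lemma Xi_num_minus: "Xi_num n (- \<zeta>) = - Xi_num n \<zeta>"
  by (simp add: Xi_num_def)

lemma pade_P_diagonal:
  assumes n: "n > 0"
  shows "poly (pade_P n n) (\<i> * of_real \<zeta>) =
    (-1) ^ n * (of_real (Xi_den n \<zeta>) - \<i> * of_real (Xi_num n \<zeta>))"
proof -
  have "poly (pade_P n n) (\<i> * of_real \<zeta>) =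
      (-1) ^ n * (\<Sum>j\<le>n. fact (n + n - j) / (fact j * fact (n - j)) * (\<i> * complex_of_real (- \<zeta>)) ^ j)"
    unfolding poly_pade_P sum_distrib_left
  proof (intro sum.cong refl)
    fix j assume j: "j \<in> {..n}"
    have eq: "(-1) ^ n * (\<i> * complex_of_real (- \<zeta>)) ^ j = (-1) ^ (n - j) * (\<i> * complex_of_real \<zeta>) ^ j"
    proof -
      have "(-1) ^ n = (-1) ^ (n - j) * (-1 :: complex) ^ j"
        using j by (simp flip: power_add)
      moreover have "(-1) ^ j * (\<i> * complex_of_real (- \<zeta>)) ^ j = (\<i> * complex_of_real \<zeta>) ^ j"
        unfolding power_mult_distrib[symmetric] by simp
      ultimately show ?thesis by (simp only: mult.assoc)
    qed
    have "(-1) ^ n * (fact (n + n - j) / (fact j * fact (n - j)) * (\<i> * complex_of_real (- \<zeta>)) ^ j) =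
        fact (n + n - j) / (fact j * fact (n - j)) * ((-1) ^ n * (\<i> * complex_of_real (- \<zeta>)) ^ j)"
      by (simp only: mult.left_commute)
    also have "\<dots> = coeff (pade_P n n) j * (\<i> * complex_of_real \<zeta>) ^ j"
      unfolding eq using j by (simp add: coeff_pade_P)
    finally show "coeff (pade_P n n) j * (\<i> * complex_of_real \<zeta>) ^ j =
        (-1) ^ n * (fact (n + n - j) / (fact j * fact (n - j)) * (\<i> * complex_of_real (- \<zeta>)) ^ j)" ..
  qed
  then show ?thesis
    unfolding pade_diagonal_imaginary[OF n] by (simp add: Xi_den_minus Xi_num_minus)
qed

lemma pade_Q_diagonal:
  assumes n: "n > 0"
  shows "poly (pade_Q n n) (\<i> * of_real \<zeta>) =
    - ((-1) ^ n * (of_real (Xi_den n \<zeta>) + \<i> * of_real (Xi_num n \<zeta>)))"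
proof -
  have "poly (pade_Q n n) (\<i> * of_real \<zeta>) =
      (-1) ^ (n - 1) * (\<Sum>j\<le>n. fact (n + n - j) / (fact j * fact (n - j)) * (\<i> * complex_of_real \<zeta>) ^ j)"
    unfolding poly_pade_Q sum_distrib_left by (intro sum.cong refl) (simp add: coeff_pade_Q)
  moreover have "(-1 :: complex) ^ n = - ((-1) ^ (n - 1))"
    using n by (cases n) auto
  ultimately show ?thesis unfolding pade_diagonal_imaginary[OF n] by simp
qed

text \<open>
  By the two preceding lemmas, \<open>exp (z / 2)\<close> times the left-hand side is a difference of two conjugate
  numbers, so its vanishing is a single real equation.
\<close>

lemma diagonal_root_iff:
  assumes n: "n > 0"
  shows "poly (pade_P n n) (\<i> * of_real \<zeta>) + exp (- (\<i> * of_real \<zeta>)) * poly (pade_Q n n) (\<i> * of_real \<zeta>) = 0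
    \<longleftrightarrow> sin (\<zeta> / 2) * Xi_den n \<zeta> = cos (\<zeta> / 2) * Xi_num n \<zeta>"
proof -
  define c s D N where "c = cos (\<zeta> / 2)" and "s = sin (\<zeta> / 2)"
    and "D = Xi_den n \<zeta>" and "N = Xi_num n \<zeta>"
  define u where "u = poly (pade_P n n) (\<i> * of_real \<zeta>) +
    exp (- (\<i> * of_real \<zeta>)) * poly (pade_Q n n) (\<i> * of_real \<zeta>)"
  define e where "e = exp (\<i> * of_real (\<zeta> / 2))"
  have e: "e = of_real c + \<i> * of_real s"
    unfolding e_def c_def s_def exp_Euler cos_of_real sin_of_real ..
  have e': "e * exp (- (\<i> * of_real \<zeta>)) = of_real c - \<i> * of_real s"
  proof -
    have "e * exp (- (\<i> * of_real \<zeta>)) = exp (- (\<i> * of_real (\<zeta> / 2)))"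
      unfolding e_def exp_add[symmetric] by (rule arg_cong[of _ _ exp]) (simp add: field_simps)
    also have "\<dots> = of_real c - \<i> * of_real s"
      unfolding exp_minus_Euler cos_of_real sin_of_real c_def s_def ..
    finally show ?thesis .
  qed
  have "e * u = e * ((-1) ^ n * (of_real D - \<i> * of_real N)) -
      (e * exp (- (\<i> * of_real \<zeta>))) * ((-1) ^ n * (of_real D + \<i> * of_real N))"
    unfolding u_def pade_P_diagonal[OF n] pade_Q_diagonal[OF n] D_def N_def by (simp add: algebra_simps)
  also have "\<dots> = (-1) ^ n * (2 * \<i> * of_real (s * D - c * N))"
    unfolding e' unfolding e by (simp add: complex_eq_iff algebra_simps) 
  finally have "u = 0 \<longleftrightarrow> s * D - c * N = 0"
    using exp_not_eq_zero[of "\<i> * of_real (\<zeta> / 2)"]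
    by (metis e_def mult_eq_0_iff of_real_eq_0_iff complex_i_not_zero power_not_zero zero_neq_numeral neg_equal_0_iff_equal one_neq_zero)
  then show ?thesis by (simp add: u_def c_def s_def D_def N_def)
qed

text \<open>
  For \<open>m = n\<close> the difference \<open>P - Q\<close> has rational coefficients and equals \<open>2 * Xi_den n \<zeta>\<close> up to
  sign at \<open>\<i> \<zeta>\<close>.
\<close>

lemma Xi_den_zero_imp_algebraic:
  assumes n: "n > 0" and zero: "Xi_den n \<zeta> = 0"
  shows "algebraic (\<i> * complex_of_real \<zeta>)"
  unfolding algebraic_altdef
proof (intro exI conjI allI)
  let ?p = "pade_P n n - pade_Q n n"
  have fact_Rats: "fact k \<in> (\<rat> :: complex set)" for k
    by (metis Rats_of_nat of_nat_fact)
  show "coeff ?p i \<in> \<rat>" for i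
    by (simp add: coeff_pade_P coeff_pade_Q)
       (intro conjI impI Rats_diff Rats_divide Rats_mult Rats_power fact_Rats; simp)
  show "?p \<noteq> 0"
  proof
    assume "?p = 0"
    then have "coeff (pade_P n n) 0 = coeff (pade_Q n n) 0" by simp
    moreover have "(-1 :: complex) ^ n = - ((-1) ^ (n - 1))"
      using n by (cases n) auto
    ultimately show False by (simp add: coeff_pade_P coeff_pade_Q)
  qed
  show "poly ?p (\<i> * complex_of_real \<zeta>) = 0"
    by (simp add: pade_P_diagonal pade_Q_diagonal n zero)
qed

text \<open>
  The content is that the equation without division never has a solution at a pole of the tangent or
  at a zero of the denominator.
\<close>

lemma Xi_iff:
  assumes n: "n > 0"
  shows "\<zeta> \<in> Xi n \<longleftrightarrow> sin (\<zeta> / 2) * Xi_den n \<zeta> = cos (\<zeta> / 2) * Xi_num n \<zeta>"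
proof
  assume eq: "sin (\<zeta> / 2) * Xi_den n \<zeta> = cos (\<zeta> / 2) * Xi_num n \<zeta>"
  have cos0: "cos (\<zeta> / 2) \<noteq> 0"
  proof
    assume cos: "cos (\<zeta> / 2) = 0"
    then have "sin (\<zeta> / 2) \<noteq> 0"
      using sin_cos_squared_add[of "\<zeta> / 2"] by auto
    then have "Xi_den n \<zeta> = 0" using eq cos by simp
    then have "algebraic (\<i> * complex_of_real \<zeta>)" by (rule Xi_den_zero_imp_algebraic[OF n])
    moreover have "exp (\<i> * complex_of_real \<zeta>) = -1"
    proof -
      have "cos \<zeta> = -1" using cos_double_cos[of "\<zeta> / 2"] cos by simp
      moreover have "sin \<zeta> = 0" using sin_double[of "\<zeta> / 2"] cos by simp
      ultimately show ?thesis by (simp add: exp_Euler cos_of_real sin_of_real)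
    qed
    ultimately show False using algebraic_imp_exp_neq_minus_one by blast
  qed
  have den0: "Xi_den n \<zeta> \<noteq> 0"
  proof
    assume den: "Xi_den n \<zeta> = 0"
    then have "Xi_num n \<zeta> = 0" using eq cos0 by simp
    then have "\<i> * complex_of_real \<zeta> = 0"
      using pade_no_common_root[OF n, of n "\<i> * complex_of_real \<zeta>"] den
      by (simp add: pade_P_diagonal pade_Q_diagonal n)
    then have "\<zeta> = 0" by simp
    then show False using den by (simp add: Xi_den_def power_0_left if_distrib sum.If_cases)
  qed
  show "\<zeta> \<in> Xi n"
    using eq cos0 den0 by (simp add: Xi_def tan_def frac_eq_eq mult.commute)
next
  assume "\<zeta> \<in> Xi n"
  then show "sin (\<zeta> / 2) * Xi_den n \<zeta> = cos (\<zeta> / 2) * Xi_num n \<zeta>"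
    by (auto simp: Xi_def tan_def frac_eq_eq mult.commute)
qed

section \<open>Dominance of the multiple root\<close>

theorem theorem3p6:
  fixes n m :: nat and \<tau> s0 :: real and a \<alpha> :: "nat \<Rightarrow> real"
  assumes "n > 0" and "m \<le> n" and "\<tau> > 0"
    and "\<forall>k<n. a k =
           real (n choose k) * (- s0) ^ (n - k)
           + (-1) ^ (n - k) * fact n *
             (\<Sum>j=k..n-1. real (j choose k) * real ((m + n - j) choose m) * s0 ^ (j - k)
                            / (fact j * \<tau> ^ (n - j)))"
    and "\<forall>k\<le>m. \<alpha> k =
           (-1) ^ (n - 1) * exp (s0 * \<tau>) *
             (\<Sum>j=k..m. (-1) ^ (j - k) * fact (m + n - j) * s0 ^ (j - k)
                          / (fact k * fact (j - k) * fact (m - j) * \<tau> ^ (n - j)))"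
  shows "(m < n \<longrightarrow>
            strictly_dominant_root (quasipolynomial n m \<tau> a \<alpha>) (complex_of_real s0))
       \<and> (m = n \<longrightarrow>
            dominant_root (quasipolynomial n m \<tau> a \<alpha>) (complex_of_real s0)
          \<and> (\<forall>s. s \<noteq> complex_of_real s0 \<longrightarrow> quasipolynomial n m \<tau> a \<alpha> s = 0 \<longrightarrow> Re s = s0)
          \<and> {s. quasipolynomial n m \<tau> a \<alpha> s = 0}
              = {complex_of_real s0 + \<i> * complex_of_real (\<zeta> / \<tau>) | \<zeta>. \<zeta> \<in> Xi n})"
proof -
  define u where "u z = poly (pade_P n m) z + exp (- z) * poly (pade_Q n m) z" for z
  let ?\<Delta> = "quasipolynomial n m \<tau> a \<alpha>"
  define Z where "Z s = complex_of_real \<tau> * (s - complex_of_real s0)" for s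
  have \<tau>: "complex_of_real \<tau> \<noteq> 0" using assms(3) by simp
  have "?\<Delta> s = u (Z s) / complex_of_real \<tau> ^ n" for s
  proof -
    have "exp (- s * complex_of_real \<tau>) * exp (complex_of_real (s0 * \<tau>)) = exp (- Z s)"
      by (simp add: Z_def algebra_simps flip: exp_add)
    then show ?thesis
      unfolding quasipolynomial_def quasipolynomial_undelayed_part[OF assms(3,1,4)]
        quasipolynomial_delayed_part[OF assms(3,2,5)] u_def
      by (simp add: Z_def add_divide_distrib mult.assoc[symmetric])
  qed
  then have root: "?\<Delta> s = 0 \<longleftrightarrow> u (Z s) = 0" for s
    using \<tau> by simp
  have "(-1 :: complex) ^ n = - ((-1) ^ (n - 1))"
    using assms(1) by (cases n) auto
  then have "u 0 = 0"
    using assms(2) by (simp add: u_def poly_0_coeff_0 coeff_pade_P coeff_pade_Q)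
  then have s0: "?\<Delta> (complex_of_real s0) = 0" by (simp add: root Z_def)
  have Z0: "Z s \<noteq> 0" if "s \<noteq> complex_of_real s0" for s
    using \<tau> that by (simp add: Z_def)
  have ReZ: "Re (Z s) = \<tau> * (Re s - s0)" for s by (simp add: Z_def)
  have strict: "Re s < s0" if "m < n" "s \<noteq> complex_of_real s0" "?\<Delta> s = 0" for s
    using pade_root_location(1)[OF assms(1,2) Z0[OF that(2)]] that assms(3)
    unfolding root u_def ReZ by (simp add: mult_less_0_iff)
  have vertical: "Re s = s0" if "m = n" "s \<noteq> complex_of_real s0" "?\<Delta> s = 0" for s
    using pade_root_location(2)[OF assms(1,2) Z0[OF that(2)]] that assms(3)
    unfolding root u_def ReZ by simp
  have set: "{s. ?\<Delta> s = 0} = {complex_of_real s0 + \<i> * complex_of_real (\<zeta> / \<tau>) | \<zeta>. \<zeta> \<in> Xi n}"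
    if mn: "m = n"
  proof -
    have Z: "Z (complex_of_real s0 + \<i> * complex_of_real (\<zeta> / \<tau>)) = \<i> * complex_of_real \<zeta>" for \<zeta>
      using \<tau> by (simp add: Z_def)
    have on_line: "?\<Delta> (complex_of_real s0 + \<i> * complex_of_real (\<zeta> / \<tau>)) = 0 \<longleftrightarrow> \<zeta> \<in> Xi n" for \<zeta>
      unfolding root Z Xi_iff[OF assms(1)] diagonal_root_iff[OF assms(1), symmetric] by (simp add: u_def mn)
    have "\<exists>\<zeta>. s = complex_of_real s0 + \<i> * complex_of_real (\<zeta> / \<tau>)" if "?\<Delta> s = 0" for s
    proof
      have "Re s = s0" using vertical[OF mn _ that] by (cases "s = complex_of_real s0") auto
      then show "s = complex_of_real s0 + \<i> * complex_of_real ((\<tau> * Im s) / \<tau>)"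
        using assms(3) by (simp add: complex_eq_iff)
    qed
    then show ?thesis using on_line by blast
  qed
  show ?thesis
    unfolding strictly_dominant_root_def dominant_root_def
    using s0 strict vertical set by (auto intro: order_less_imp_le)
qed

end
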